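(* Let $k \ge 3$ be an integer and let $X = X_{N,p}^{k\text{-AP}}$ denote the number of $k$-term arithmetic progressions in the random set $[N]_p$. Then, for every fixed positive constant $\delta$ and all $p = p(N)$ satisfying $N^{-1} \ll p^{k/2} \ll N^{-1}\log N$, $$\lim_{N\to\infty} \frac{-\log \mathbb{P}\big(X \ge (1+\delta)\mathbb{E}[X]\big)}{\mathbb{E}[X]} = (1+\delta)\log(1+\delta)-\delta.$$
   Context: Write $[N]=\{1,\dots,N\}$. For $p\in(0,1)$, $[N]_p$ denotes the random subset of $[N]$ obtained by including every element independently with probability $p$. A $k$-term arithmetic progression is a sequence of $k$ integers $(a,a+b,a+2b,\dots,a+(k-1)b)$ with $b>0$ (so degenerate progressions are not counted and each progression is counted once); it is in $[N]_p$ if all its terms are. For functions of $N$, $f \ll g$ means $f(N)/g(N)\to 0$ as $N\to\infty$. Logarithms are natural. *)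

theory Defs
  imports "HOL-Probability.Probability"
begin

definition binomial_random_set :: "nat \<Rightarrow> real \<Rightarrow> int set pmf" where
  "binomial_random_set N p =
     map_pmf (\<lambda>\<xi>. {x \<in> {1..int N}. \<xi> x})
       (Pi_pmf {1..int N} False (\<lambda>_. bernoulli_pmf p))"

definition is_AP :: "nat \<Rightarrow> int list \<Rightarrow> bool" where
  "is_AP k xs \<longleftrightarrow> (\<exists>a b. b > 0 \<and> xs = map (\<lambda>i. a + int i * b) [0..<k])"

text \<open>Only meaningful for finite \<open>S\<close> and positive \<open>k\<close>, since the cardinality of an infinite
  set is \<open>0\<close>.\<close>

definition AP_count :: "nat \<Rightarrow> int set \<Rightarrow> nat" where
  "AP_count k S = card {xs. is_AP k xs \<and> set xs \<subseteq> S}"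

definition AP_mean :: "nat \<Rightarrow> nat \<Rightarrow> real \<Rightarrow> real" where
  "AP_mean k N p =
     measure_pmf.expectation (binomial_random_set N p) (\<lambda>S. real (AP_count k S))"

definition AP_upper_tail :: "nat \<Rightarrow> nat \<Rightarrow> real \<Rightarrow> real \<Rightarrow> real" where
  "AP_upper_tail k N p \<delta> =
     measure_pmf.prob (binomial_random_set N p)
       {S. real (AP_count k S) \<ge> (1 + \<delta>) * AP_mean k N p}"

definition much_less :: "(nat \<Rightarrow> real) \<Rightarrow> (nat \<Rightarrow> real) \<Rightarrow> bool" where
  "much_less f g \<longleftrightarrow> (\<lambda>N. f N / g N) \<longlonglongrightarrow> 0"

end

theory Submission
  imports Defs "HOL-Real_Asymp.Real_Asymp"
begin

text \<open>
  Write \<open>\<mu>\<close> for the mean and \<open>M\<close> for the number of progressions, so \<open>\<mu> = M p\<^sup>k\<close>; the hypotheses say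
  \<open>1 \<ll> \<mu> \<ll> (log N)\<^sup>2\<close>.

  Upper bound: if more than \<open>\<epsilon>\<mu>\<close> progressions in the random set meet another one, then the set
  contains a union of clusters on at least about \<open>\<surd>(\<epsilon>\<mu>)\<close> points. Such a union is built in
  at least \<open>c\<surd>\<mu>\<close> steps, each of which costs a factor \<open>N powr (- c)\<close> in expectation, so it
  appears with probability at most \<open>exp (- c' \<surd>\<mu> log N)\<close>, which is negligible. The remaining
  progressions are pairwise disjoint, and the factorial moment of order about \<open>\<delta>\<mu>\<close> of the number of
  disjoint progressions gives the Poisson tail.

  Lower bound: for a family of \<open>n \<approx> (1 + \<delta>)\<mu>\<close> progressions whose union contains no further
  progression, Harris' inequality bounds from below the probability that these are exactly the
  progressions in the random set by \<open>p\<^sup>k\<^sup>n exp (- (1 + o(1)) \<mu>)\<close>. These events are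
  disjoint, and there are at least \<open>(M (1 - o(1)))\<^sup>n / n!\<close> of them.
\<close>

section \<open>Binomial random subsets of a finite set\<close>

text \<open>The expectation of \<open>f\<close> over a binomial random subset of \<open>V\<close>,
  written as a finite sum over subsets, so that conditioning becomes a bijection of index sets and
  inequalities can be proved by induction on \<open>V\<close>.\<close>

definition bin_exp :: "'a set \<Rightarrow> real \<Rightarrow> ('a set \<Rightarrow> real) \<Rightarrow> real" where
  "bin_exp V p f = (\<Sum>S\<in>Pow V. p ^ card S * (1 - p) ^ card (V - S) * f S)"

text \<open>Condition on whether \<open>x\<close> belongs to the random set. This recursion carries
  the inductions on \<open>V\<close> below.\<close>

lemma bin_exp_insert:
  assumes "finite V" "x \<notin> V"
  shows "bin_exp (insert x V) p f = (1 - p) * bin_exp V p f + p * bin_exp V p (\<lambda>S. f (insert x S))"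
proof -
  have disj: "Pow V \<inter> insert x ` Pow V = {}" using assms by auto
  have inj: "inj_on (insert x) (Pow V)" using assms by (auto simp: inj_on_def)
  have 1: "(\<Sum>S\<in>Pow V. p ^ card S * (1 - p) ^ card (insert x V - S) * f S) = (1 - p) * bin_exp V p f"
    unfolding bin_exp_def sum_distrib_left
  proof (intro sum.cong refl)
    fix S assume S: "S \<in> Pow V"
    then have "insert x V - S = insert x (V - S)" using assms by auto
    then have "card (insert x V - S) = Suc (card (V - S))" using assms by simp
    then show "p ^ card S * (1 - p) ^ card (insert x V - S) * f S =
      (1 - p) * (p ^ card S * (1 - p) ^ card (V - S) * f S)" by simp
  qed
  have 2: "(\<Sum>S\<in>Pow V. p ^ card (insert x S) * (1 - p) ^ card (V - S) * f (insert x S))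
      = p * bin_exp V p (\<lambda>S. f (insert x S))"
    unfolding bin_exp_def sum_distrib_left
  proof (intro sum.cong refl)
    fix S assume S: "S \<in> Pow V"
    then have "finite S" "x \<notin> S" using assms finite_subset[of S V] by auto
    then show "p ^ card (insert x S) * (1 - p) ^ card (V - S) * f (insert x S) =
      p * (p ^ card S * (1 - p) ^ card (V - S) * f (insert x S))" by simp
  qed
  show ?thesis
    unfolding bin_exp_def[of "insert x V"] Pow_insert
    using assms disj by (simp add: sum.union_disjoint sum.reindex[OF inj] 1 2)
qed

lemma bin_exp_mono:
  assumes "0 \<le> p" "p \<le> 1" "\<And>S. S \<subseteq> V \<Longrightarrow> f S \<le> g S"
  shows "bin_exp V p f \<le> bin_exp V p g"
  unfolding bin_exp_def using assms by (intro sum_mono mult_left_mono) auto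

lemma bin_exp_cong:
  assumes "\<And>S. S \<subseteq> V \<Longrightarrow> f S = g S"
  shows "bin_exp V p f = bin_exp V p g"
  unfolding bin_exp_def using assms by (intro sum.cong) auto

lemma bin_exp_sum: "bin_exp V p (\<lambda>S. \<Sum>i\<in>I. f i S) = (\<Sum>i\<in>I. bin_exp V p (f i))"
  unfolding bin_exp_def sum_distrib_left by (rule sum.swap)

lemma bin_exp_add: "bin_exp V p (\<lambda>S. f S + g S) = bin_exp V p f + bin_exp V p g"
  unfolding bin_exp_def by (simp add: ring_distribs sum.distrib)

lemma bin_exp_diff: "bin_exp V p (\<lambda>S. f S - g S) = bin_exp V p f - bin_exp V p g"
  unfolding bin_exp_def by (simp add: ring_distribs sum_subtractf)

lemma bin_exp_cmult: "bin_exp V p (\<lambda>S. c * f S) = c * bin_exp V p f"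
  unfolding bin_exp_def sum_distrib_left by (intro sum.cong) auto

lemma bin_exp_const: "finite V \<Longrightarrow> bin_exp V p (\<lambda>_. c) = c"
proof (induction V rule: finite_induct)
  case empty
  then show ?case by (simp add: bin_exp_def)
next
  case (insert x F)
  then show ?case by (simp add: bin_exp_insert algebra_simps)
qed

text \<open>Given that \<open>U\<close> is present, the other points form a binomial subset of
  \<open>V - U\<close>; the bijection is \<open>S\<close> to \<open>S - U\<close>.\<close>

lemma bin_exp_superset:
  assumes "finite V" "U \<subseteq> V"
  shows "bin_exp V p (\<lambda>S. of_bool (U \<subseteq> S) * f S) = p ^ card U * bin_exp (V - U) p (\<lambda>T. f (U \<union> T))"
proof -
  have "bin_exp V p (\<lambda>S. of_bool (U \<subseteq> S) * f S)
     = (\<Sum>S | S \<subseteq> V \<and> U \<subseteq> S. p ^ card S * (1 - p) ^ card (V - S) * f S)"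
    unfolding bin_exp_def using assms by (intro sum.mono_neutral_cong_right) auto
  also have "\<dots> = (\<Sum>T\<in>Pow (V - U). p ^ card U * (p ^ card T * (1 - p) ^ card (V - U - T) * f (U \<union> T)))"
  proof (rule sum.reindex_bij_witness[where i = "\<lambda>T. U \<union> T" and j = "\<lambda>S. S - U"])
    fix S assume S: "S \<in> {S. S \<subseteq> V \<and> U \<subseteq> S}"
    then have fin: "finite S" using assms finite_subset by auto
    have "card U + card (S - U) = card S"
      using S fin by (simp add: card_Diff_subset card_mono finite_subset[of U S])
    moreover have "V - U - (S - U) = V - S" "U \<union> (S - U) = S" using S by auto
    ultimately show "p ^ card U * (p ^ card (S - U) * (1 - p) ^ card (V - U - (S - U)) * f (U \<union> (S - U))) =
         p ^ card S * (1 - p) ^ card (V - S) * f S"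
      by (metis mult.assoc power_add)
  qed (use assms in auto)
  finally show ?thesis by (simp add: bin_exp_def sum_distrib_left)
qed

lemma bin_exp_subset:
  assumes "finite V" "U \<subseteq> V"
  shows "bin_exp V p (\<lambda>S. of_bool (U \<subseteq> S)) = p ^ card U"
  using bin_exp_superset[OF assms, of p "\<lambda>_. 1"] assms by (simp add: bin_exp_const)

text \<open>Induction on \<open>V\<close>. Let \<open>a\<close>, \<open>b\<close> be the
  expectations of \<open>f\<close>, \<open>g\<close> when \<open>x\<close> is absent and
  \<open>c\<close>, \<open>d\<close> those when it is present. After applying the induction
  hypothesis to both cases, the remaining gain is \<open>p * (1 - p) * ((a - c) * (b - d))\<close>,
  which is nonnegative because both functions are decreasing.\<close>

lemma harris_inequality:
  assumes "finite V" "0 \<le> p" "p \<le> 1"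
    and "\<And>S T. S \<subseteq> T \<Longrightarrow> T \<subseteq> V \<Longrightarrow> f T \<le> f S" "\<And>S T. S \<subseteq> T \<Longrightarrow> T \<subseteq> V \<Longrightarrow> g T \<le> g S"
  shows "bin_exp V p f * bin_exp V p g \<le> bin_exp V p (\<lambda>S. f S * g S)"
  using assms(1,4,5)
proof (induction V arbitrary: f g rule: finite_induct)
  case empty
  then show ?case by (simp add: bin_exp_def)
next
  case (insert x V)
  let ?f1 = "\<lambda>S. f (insert x S)" and ?g1 = "\<lambda>S. g (insert x S)"
  define a b c d where "a = bin_exp V p f" "b = bin_exp V p g" "c = bin_exp V p ?f1" "d = bin_exp V p ?g1"
  note abcd = this
  have "c \<le> a" unfolding abcd using assms(2,3) by (intro bin_exp_mono insert.prems) auto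
  moreover have "d \<le> b" unfolding abcd using assms(2,3) by (intro bin_exp_mono insert.prems) auto
  ultimately have "0 \<le> p * (1 - p) * ((a - c) * (b - d))"
    using assms(2,3) by (intro mult_nonneg_nonneg) auto
  moreover have "a * b \<le> bin_exp V p (\<lambda>S. f S * g S)"
    unfolding abcd by (intro insert.IH insert.prems) auto
  then have "(1 - p) * (a * b) \<le> (1 - p) * bin_exp V p (\<lambda>S. f S * g S)"
    using assms by (intro mult_left_mono) auto
  moreover have "c * d \<le> bin_exp V p (\<lambda>S. ?f1 S * ?g1 S)"
    unfolding abcd by (intro insert.IH insert.prems) auto
  then have "p * (c * d) \<le> p * bin_exp V p (\<lambda>S. ?f1 S * ?g1 S)"
    using assms by (intro mult_left_mono) auto
  ultimately have "((1 - p) * a + p * c) * ((1 - p) * b + p * d)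
    \<le> (1 - p) * bin_exp V p (\<lambda>S. f S * g S) + p * bin_exp V p (\<lambda>S. ?f1 S * ?g1 S)"
    by (simp add: algebra_simps)
  then show ?case using insert.hyps by (simp add: bin_exp_insert abcd)
qed

text \<open>A product of nonnegative decreasing functions is again decreasing, so the inequality for
  two functions can be iterated.\<close>

lemma harris_inequality_prod:
  assumes "finite I" "finite V" "0 \<le> p" "p \<le> 1"
    and "\<And>i S T. i \<in> I \<Longrightarrow> S \<subseteq> T \<Longrightarrow> T \<subseteq> V \<Longrightarrow> f i T \<le> f i S"
    and "\<And>i S. i \<in> I \<Longrightarrow> S \<subseteq> V \<Longrightarrow> 0 \<le> f i S"
  shows "(\<Prod>i\<in>I. bin_exp V p (f i)) \<le> bin_exp V p (\<lambda>S. \<Prod>i\<in>I. f i S)"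
  using assms(1,5,6)
proof (induction I rule: finite_induct)
  case empty
  then show ?case using assms(2) by (simp add: bin_exp_const)
next
  case (insert i I)
  have nn: "0 \<le> bin_exp V p (f i)"
    using bin_exp_mono[of p V "\<lambda>_. 0" "f i"] insert.prems(2)[of i] assms(2,3,4) by (simp add: bin_exp_const)
  have "(\<Prod>j\<in>insert i I. bin_exp V p (f j)) = bin_exp V p (f i) * (\<Prod>j\<in>I. bin_exp V p (f j))"
    using insert.hyps by simp
  also have "\<dots> \<le> bin_exp V p (f i) * bin_exp V p (\<lambda>S. \<Prod>j\<in>I. f j S)"
    using insert.prems nn by (intro mult_left_mono insert.IH) auto
  also have "\<dots> \<le> bin_exp V p (\<lambda>S. f i S * (\<Prod>j\<in>I. f j S))"
    using assms(2,3,4) insert.prems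
    by (intro harris_inequality prod_mono) (auto intro: subset_trans)
  finally show ?case using insert.hyps by simp
qed

section \<open>From the probability mass function to the finite sum\<close>

lemma expectation_binomial_random_set:
  fixes f :: "int set \<Rightarrow> real"
  assumes "0 \<le> p" "p \<le> 1"
  shows "measure_pmf.expectation (binomial_random_set N p) f = bin_exp {1..int N} p f"
proof -
  let ?V = "{1..int N}"
  let ?M = "Pi_pmf ?V False (\<lambda>_. bernoulli_pmf p)"
  let ?j = "\<lambda>S x. (x :: int) \<in> S"
  let ?h = "\<lambda>\<xi>. {x \<in> ?V. \<xi> x}"
  have "measure_pmf.expectation (binomial_random_set N p) f = measure_pmf.expectation ?M (\<lambda>\<xi>. f (?h \<xi>))"
    by (simp add: binomial_random_set_def)
  also have "\<dots> = (\<Sum>\<xi>\<in>?j ` Pow ?V. f (?h \<xi>) * pmf ?M \<xi>)"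
  proof (rule integral_measure_pmf_real)
    fix \<xi> assume "\<xi> \<in> set_pmf ?M"
    then have "\<xi> \<in> PiE_dflt ?V False (\<lambda>_. UNIV)"
      using set_Pi_pmf_subset[of ?V False] by (auto simp: PiE_dflt_def)
    \<comment> \<open>Outside \<open>?V\<close> the configuration takes the default value
      \<open>False\<close>, so it is the indicator function of the set read off from it.\<close>
    then have "\<xi> = ?j (?h \<xi>)" by (auto simp: PiE_dflt_def fun_eq_iff)
    then show "\<xi> \<in> ?j ` Pow ?V" by blast
  qed auto
  also have "\<dots> = (\<Sum>S\<in>Pow ?V. f (?h (?j S)) * pmf ?M (?j S))"
    by (subst sum.reindex) (auto simp: inj_on_def fun_eq_iff)
  also have "\<dots> = bin_exp ?V p f"
    unfolding bin_exp_def
  proof (intro sum.cong refl)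
    fix S assume S: "S \<in> Pow ?V"
    then have h: "?h (?j S) = S" by auto
    have "pmf ?M (?j S) = (\<Prod>x\<in>?V. pmf (bernoulli_pmf p) (x \<in> S))"
      using S by (subst pmf_Pi') auto
    also have "\<dots> = (\<Prod>x\<in>S \<union> (?V - S). if x \<in> S then p else 1 - p)"
      using S assms by (intro prod.cong) auto
    also have "\<dots> = (\<Prod>x\<in>S. if x \<in> S then p else 1 - p) * (\<Prod>x\<in>?V - S. if x \<in> S then p else 1 - p)"
      using S finite_subset[of S ?V] by (intro prod.union_disjoint) auto
    also have "\<dots> = p ^ card S * (1 - p) ^ card (?V - S)" by simp
    finally show "f (?h (?j S)) * pmf ?M (?j S) = p ^ card S * (1 - p) ^ card (?V - S) * f S"
      unfolding h by simp
  qed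
  finally show ?thesis .
qed

lemma prob_binomial_random_set:
  assumes "0 \<le> p" "p \<le> 1"
  shows "measure_pmf.prob (binomial_random_set N p) {S. Q S} = bin_exp {1..int N} p (\<lambda>S. of_bool (Q S))"
proof -
  have "measure_pmf.prob (binomial_random_set N p) {S. Q S} =
    measure_pmf.expectation (binomial_random_set N p) (indicator {S. Q S})" by simp
  also have "\<dots> = bin_exp {1..int N} p (indicator {S. Q S})"
    by (rule expectation_binomial_random_set[OF assms])
  also have "\<dots> = bin_exp {1..int N} p (\<lambda>S. of_bool (Q S))"
    by (intro bin_exp_cong) (auto simp: indicator_def)
  finally show ?thesis .
qed

section \<open>Union bounds and an elementary exponential estimate\<close>

lemma sum_UN_le:
  fixes f :: "'b \<Rightarrow> real"
  assumes "finite I" "\<And>i. i \<in> I \<Longrightarrow> finite (A i)" "\<And>x. 0 \<le> f x"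
  shows "sum f (\<Union>i\<in>I. A i) \<le> (\<Sum>i\<in>I. sum f (A i))"
proof -
  have "(\<Union>i\<in>I. A i) = snd ` Sigma I A" by force
  then have "sum f (\<Union>i\<in>I. A i) \<le> sum (f \<circ> snd) (Sigma I A)"
    by (simp only:) (intro sum_image_le finite_SigmaI assms)
  also have "\<dots> = (\<Sum>i\<in>I. sum f (A i))"
    using assms by (simp add: sum.Sigma comp_def split_def)
  finally show ?thesis .
qed

lemma sum_Un_le:
  fixes f :: "'b \<Rightarrow> real"
  assumes "finite A" "finite B" "\<And>x. 0 \<le> f x"
  shows "sum f (A \<union> B) \<le> sum f A + sum f B"
  using sum.union_inter[OF assms(1,2), of f] sum_nonneg[of "A \<inter> B" f] assms(3) by simp

lemma card_UN_le_mult: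
  assumes "finite I" "\<And>i. i \<in> I \<Longrightarrow> card (A i) \<le> c"
  shows "card (\<Union>i\<in>I. A i) \<le> card I * c"
  using card_UN_le[OF assms(1), of A] sum_bounded_above[of I "\<lambda>i. card (A i)" c] assms(2) by force

text \<open>Invert \<open>1 / (1 - x) = 1 + x / (1 - x) \<le> exp (x / (1 - x))\<close>. The common
  bound \<open>q\<close> gives one denominator for all factors of a product, whose exponents can
  then be added.\<close>

lemma exp_le_one_minus:
  fixes x q :: real
  assumes "0 \<le> x" "x \<le> q" "q < 1"
  shows "exp (- x / (1 - q)) \<le> 1 - x"
proof -
  have "1 / (1 - x) = 1 + x / (1 - x)" using assms by (simp add: field_simps)
  also have "\<dots> \<le> exp (x / (1 - x))" by (rule exp_ge_add_one_self)
  also have "x / (1 - x) \<le> x / (1 - q)" using assms by (intro divide_left_mono) auto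
  finally have "1 / (1 - x) \<le> exp (x / (1 - q))" by simp
  then show ?thesis using assms by (simp add: exp_minus field_simps)
qed

section \<open>Sparse uniform hypergraphs\<close>

text \<open>The features of progressions on which both tail bounds rest: few edges through a point
  and few through a pair of points. For progressions in [N] the bounds are \<open>d = k * N\<close>
  and \<open>D = k\<^sup>2\<close>.\<close>

locale sparse_hypergraph =
  fixes V :: "'a set" and E :: "'a set set" and k d D :: nat and p :: real
  assumes finite_V: "finite V"
    and edge_subset: "A \<in> E \<Longrightarrow> A \<subseteq> V"
    and edge_card: "A \<in> E \<Longrightarrow> card A = k"
    and k_ge_3: "3 \<le> k"
    and degree_le: "card {A \<in> E. v \<in> A} \<le> d"
    and codegree_le: "v \<noteq> w \<Longrightarrow> card {A \<in> E. v \<in> A \<and> w \<in> A} \<le> D"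
    and p_pos: "0 < p" and p_less_1: "p < 1"
begin

definition prob :: "('a set \<Rightarrow> bool) \<Rightarrow> real" where
  "prob Q = bin_exp V p (\<lambda>S. of_bool (Q S))"

definition edges_in :: "'a set \<Rightarrow> 'a set set" where
  "edges_in S = {A \<in> E. A \<subseteq> S}"

definition mean :: real where "mean = card E * p ^ k"

text \<open>Bounds the expected number of edges that meet a given set of \<open>u\<close> present
  points without lying inside it. At most \<open>u * d\<close> edges meet it in one point and need
  \<open>k - 1\<close> further points; at most \<open>u ^ 2 * D\<close> meet it in two or more
  points and need at least one further point.\<close>

definition overlap :: "nat \<Rightarrow> real" where
  "overlap u = u * d * p ^ (k - 1) + u ^ 2 * D * p"

lemma finite_E: "finite E"
  using finite_V edge_subset by (intro finite_subset[of E "Pow V"]) auto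

lemma finite_edge: "A \<in> E \<Longrightarrow> finite A"
  using edge_subset finite_V finite_subset by blast

lemma finite_edges_in: "finite (edges_in S)"
  using finite_E by (simp add: edges_in_def)

lemma edge_subset_eq: "A \<in> E \<Longrightarrow> B \<in> E \<Longrightarrow> B \<subseteq> A \<Longrightarrow> B = A"
  using card_subset_eq[of A B] finite_edge edge_card by metis

lemma prob_mono: "(\<And>S. S \<subseteq> V \<Longrightarrow> Q S \<Longrightarrow> R S) \<Longrightarrow> prob Q \<le> prob R"
  unfolding prob_def using p_pos p_less_1 by (intro bin_exp_mono) auto

lemma prob_disj_le: "prob (\<lambda>S. Q S \<or> R S) \<le> prob Q + prob R"
  unfolding prob_def bin_exp_add[symmetric] using p_pos p_less_1 by (intro bin_exp_mono) auto

section \<open>Edges meeting a given set of points\<close>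

lemma card_edges_meeting_le:
  assumes "finite W"
  shows "card {A \<in> E. A \<inter> W \<noteq> {}} \<le> card W * d"
proof -
  have "{A \<in> E. A \<inter> W \<noteq> {}} = (\<Union>w\<in>W. {A \<in> E. w \<in> A})" by auto
  also have "card \<dots> \<le> (\<Sum>w\<in>W. card {A \<in> E. w \<in> A})" using assms by (rule card_UN_le)
  also have "\<dots> \<le> (\<Sum>w\<in>W. d)" by (intro sum_mono degree_le)
  finally show ?thesis by simp
qed

text \<open>Such an edge contains an ordered pair of distinct points of \<open>W\<close>, and each
  pair lies in at most \<open>D\<close> edges.\<close>

lemma card_edges_meeting_twice_le:
  assumes "finite W"
  shows "card {A \<in> E. 2 \<le> card (A \<inter> W)} \<le> card W ^ 2 * D"
proof -
  let ?P = "{(v, w). v \<in> W \<and> w \<in> W \<and> v \<noteq> w}"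
  have P: "?P \<subseteq> W \<times> W" by auto
  have "{A \<in> E. 2 \<le> card (A \<inter> W)} \<subseteq> (\<Union>x\<in>?P. {A \<in> E. fst x \<in> A \<and> snd x \<in> A})"
  proof
    fix A assume A: "A \<in> {A \<in> E. 2 \<le> card (A \<inter> W)}"
    then obtain T where "T \<subseteq> A \<inter> W" "card T = 2" using ex_card by blast
    then obtain v w where "v \<noteq> w" "{v, w} \<subseteq> A \<inter> W" by (metis card_2_iff)
    then show "A \<in> (\<Union>x\<in>?P. {A \<in> E. fst x \<in> A \<and> snd x \<in> A})" using A by force
  qed
  then have "card {A \<in> E. 2 \<le> card (A \<inter> W)} \<le> card (\<Union>x\<in>?P. {A \<in> E. fst x \<in> A \<and> snd x \<in> A})"
    using finite_E assms finite_subset[OF P] by (intro card_mono) auto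
  also have "\<dots> \<le> (\<Sum>x\<in>?P. card {A \<in> E. fst x \<in> A \<and> snd x \<in> A})"
    using assms finite_subset[OF P] by (intro card_UN_le) auto
  also have "\<dots> \<le> (\<Sum>x\<in>?P. D)" by (intro sum_mono codegree_le) auto
  also have "\<dots> = card ?P * D" by simp
  also have "\<dots> \<le> card (W \<times> W) * D" using P assms by (intro mult_right_mono card_mono) auto
  finally show ?thesis by (simp add: power2_eq_square card_cartesian_product)
qed

lemma card_edges_in_le:
  assumes "finite W"
  shows "card (edges_in W) \<le> card W ^ 2 * D"
proof -
  have "A \<in> edges_in W \<Longrightarrow> A \<in> {A \<in> E. 2 \<le> card (A \<inter> W)}" for A
    using edge_card[of A] k_ge_3 by (simp add: edges_in_def Int_absorb2)
  then have "card (edges_in W) \<le> card {A \<in> E. 2 \<le> card (A \<inter> W)}"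
    using finite_E by (intro card_mono) auto
  with card_edges_meeting_twice_le[OF assms] show ?thesis by simp
qed

lemma overlap_nonneg: "0 \<le> overlap u"
  unfolding overlap_def using p_pos by simp

lemma overlap_mono: "u \<le> v \<Longrightarrow> overlap u \<le> overlap v"
  unfolding overlap_def using p_pos by (intro add_mono mult_right_mono) (auto intro!: power_mono mult_right_mono)

lemma sum_meeting_le_overlap:
  assumes "finite W"
  shows "(\<Sum>A | A \<in> E \<and> A \<inter> W \<noteq> {} \<and> \<not> A \<subseteq> W. p ^ card (A - W)) \<le> overlap (card W)"
proof -
  let ?M = "{A \<in> E. A \<inter> W \<noteq> {} \<and> \<not> A \<subseteq> W}"
  let ?M1 = "{A \<in> ?M. card (A \<inter> W) = 1}" and ?M2 = "{A \<in> ?M. card (A \<inter> W) \<noteq> 1}"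
  have "(\<Sum>A\<in>?M1. p ^ card (A - W)) = (\<Sum>A\<in>?M1. p ^ (k - 1))"
  proof (intro sum.cong refl)
    fix A assume "A \<in> ?M1"
    then have "card (A - W) = k - 1" using card_Diff_subset_Int[of A W] assms edge_card[of A] by simp
    then show "p ^ card (A - W) = p ^ (k - 1)" by simp
  qed
  also have "\<dots> = card ?M1 * p ^ (k - 1)" by simp
  also have "\<dots> \<le> (card W * d) * p ^ (k - 1)"
  proof (intro mult_right_mono of_nat_mono)
    show "card ?M1 \<le> card W * d"
      using card_edges_meeting_le[OF assms] finite_E card_mono[of "{A \<in> E. A \<inter> W \<noteq> {}}" ?M1]
      by fastforce
  qed (use p_pos in auto)
  finally have 1: "(\<Sum>A\<in>?M1. p ^ card (A - W)) \<le> (card W * d) * p ^ (k - 1)" .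
  have "(\<Sum>A\<in>?M2. p ^ card (A - W)) \<le> (\<Sum>A\<in>?M2. p ^ 1)"
  proof (intro sum_mono power_decreasing)
    fix A assume A: "A \<in> ?M2"
    then have "A - W \<noteq> {}" "finite A" using finite_edge by auto
    then show "1 \<le> card (A - W)" by (simp add: Suc_leI card_gt_0_iff)
  qed (use p_pos p_less_1 in auto)
  also have "\<dots> = card ?M2 * p" by simp
  also have "\<dots> \<le> (card W ^ 2 * D) * p"
  proof (intro mult_right_mono of_nat_mono)
    have "A \<in> {A \<in> E. 2 \<le> card (A \<inter> W)}" if "A \<in> ?M2" for A
    proof -
      have "card (A \<inter> W) \<noteq> 0" using that assms by auto
      then show ?thesis using that by auto
    qed
    then have "card ?M2 \<le> card {A \<in> E. 2 \<le> card (A \<inter> W)}"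
      using finite_E by (intro card_mono) auto
    then show "card ?M2 \<le> card W ^ 2 * D"
      using card_edges_meeting_twice_le[OF assms] by simp
  qed (use p_pos in auto)
  finally have 2: "(\<Sum>A\<in>?M2. p ^ card (A - W)) \<le> (card W ^ 2 * D) * p" .
  have "sum (\<lambda>A. p ^ card (A - W)) ?M = sum (\<lambda>A. p ^ card (A - W)) (?M1 \<union> ?M2)"
    by (intro sum.cong) auto
  also have "\<dots> = sum (\<lambda>A. p ^ card (A - W)) ?M1 + sum (\<lambda>A. p ^ card (A - W)) ?M2"
    using finite_E by (intro sum.union_disjoint) auto
  finally show ?thesis using 1 2 by (simp add: overlap_def)
qed

section \<open>Clusters of intersecting edges\<close>

text \<open>One step of building a cluster: add an edge that meets \<open>W\<close> and brings a new
  point, or, away from \<open>W\<close>, add two intersecting edges. Both kinds of step have small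
  expected cost, which a single edge disjoint from \<open>W\<close> would not have.\<close>

definition grow :: "'a set \<Rightarrow> 'a set set" where
  "grow W = (\<lambda>A. W \<union> A) ` {A \<in> E. A \<inter> W \<noteq> {} \<and> \<not> A \<subseteq> W} \<union>
     (\<lambda>(A, B). W \<union> (A \<union> B)) `
       {(A, B). A \<in> E \<and> B \<in> E \<and> A \<inter> W = {} \<and> B \<inter> W = {} \<and> B \<inter> A \<noteq> {} \<and> \<not> B \<subseteq> A}"

text \<open>The point sets reachable in \<open>j\<close> steps. Starting from the empty set, the
  first step always adds an intersecting pair.\<close>

primrec clusters :: "nat \<Rightarrow> 'a set set" where
  "clusters 0 = {{}}"
| "clusters (Suc j) = (\<Union>W\<in>clusters j. grow W)"

text \<open>The edges in \<open>S\<close> outside \<open>crossing S\<close> are pairwise disjoint,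
  so only the crossing ones obstruct the matching bound.\<close>

definition crossing :: "'a set \<Rightarrow> 'a set set" where
  "crossing S = {A \<in> edges_in S. \<exists>B\<in>edges_in S. B \<noteq> A \<and> A \<inter> B \<noteq> {}}"

lemma grow_subset:
  assumes "W \<subseteq> V" "U \<in> grow W"
  shows "U \<subseteq> V"
proof -
  from assms consider A where "A \<in> E" "U = W \<union> A"
    | A B where "A \<in> E" "B \<in> E" "U = W \<union> (A \<union> B)"
    unfolding grow_def by auto
  then show ?thesis using edge_subset assms(1) by cases auto
qed

lemma card_grow_le:
  assumes "U \<in> grow W"
  shows "card U \<le> card W + 2 * k"
proof -
  have un: "card (A \<union> B) \<le> card A + card B" for A B :: "'a set" by (rule card_Un_le)
  from assms consider A where "A \<in> E" "U = W \<union> A"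
    | A B where "A \<in> E" "B \<in> E" "U = W \<union> (A \<union> B)"
    unfolding grow_def by auto
  then show ?thesis
  proof cases
    case 1
    then show ?thesis using un[of W A] edge_card[of A] by simp
  next
    case 2
    then show ?thesis using un[of W "A \<union> B"] un[of A B] edge_card[of A] edge_card[of B] by simp
  qed
qed

lemma clusters_subset: "W \<in> clusters j \<Longrightarrow> W \<subseteq> V"
proof (induction j arbitrary: W)
  case (Suc j)
  then obtain U where "U \<in> clusters j" "W \<in> grow U" by auto
  then show ?case using Suc.IH[of U] grow_subset[of U W] by simp
qed simp

lemma card_cluster_le: "W \<in> clusters j \<Longrightarrow> card W \<le> 2 * k * j"
proof (induction j arbitrary: W)
  case (Suc j)
  then obtain U where "U \<in> clusters j" "W \<in> grow U" by auto
  then show ?case using Suc.IH[of U] card_grow_le[of W U] by simp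
qed simp

lemma finite_clusters: "finite (clusters j)"
  by (rule finite_subset[of _ "Pow V"]) (use finite_V in \<open>blast dest: clusters_subset\<close>)+

lemma finite_grow: "W \<subseteq> V \<Longrightarrow> finite (grow W)"
  by (rule finite_subset[of _ "Pow V"]) (use finite_V in \<open>blast dest: grow_subset\<close>)+

text \<open>A step by one edge multiplies the weight by \<open>p ^ card (A - W)\<close>, in total at
  most \<open>overlap (card W)\<close>. In a step by a pair, \<open>A\<close> costs
  \<open>p ^ k\<close>, which sums to \<open>mean\<close>, and for each \<open>A\<close> the new
  points of \<open>B\<close> cost at most \<open>overlap k\<close> in total. Different edges may
  produce the same set, hence only an inequality for the sums over images.\<close>

lemma sum_grow_le:
  assumes "W \<subseteq> V"
  shows "(\<Sum>U\<in>grow W. p ^ card U) \<le> p ^ card W * (overlap (card W) + mean * overlap k)"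
proof -
  have finW: "finite W" using assms finite_V finite_subset by auto
  let ?M = "{A \<in> E. A \<inter> W \<noteq> {} \<and> \<not> A \<subseteq> W}"
  let ?P = "{(A, B). A \<in> E \<and> B \<in> E \<and> A \<inter> W = {} \<and> B \<inter> W = {} \<and> B \<inter> A \<noteq> {} \<and> \<not> B \<subseteq> A}"
  let ?Q = "Sigma E (\<lambda>A. {B \<in> E. B \<inter> A \<noteq> {} \<and> \<not> B \<subseteq> A})"
  have card_Un: "card (X \<union> Y) = card X + card (Y - X)" if "finite X" "finite Y" for X Y :: "'a set"
    using card_Un_disjoint[of X "Y - X"] that by auto
  have finM: "finite ?M" and finQ: "finite ?Q" using finite_E by auto
  have PQ: "?P \<subseteq> ?Q" by auto
  then have finP: "finite ?P" using finQ finite_subset by blast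
  have "(\<Sum>U\<in>(\<lambda>A. W \<union> A) ` ?M. p ^ card U) \<le> (\<Sum>A\<in>?M. p ^ card (W \<union> A))"
    using sum_image_le[OF finM, of "\<lambda>U. p ^ card U" "\<lambda>A. W \<union> A"] p_pos by (simp add: comp_def)
  also have "\<dots> = (\<Sum>A\<in>?M. p ^ card W * p ^ card (A - W))"
    by (intro sum.cong refl) (auto simp: card_Un finW finite_edge power_add)
  also have "\<dots> = p ^ card W * (\<Sum>A\<in>?M. p ^ card (A - W))" by (simp add: sum_distrib_left)
  also have "\<dots> \<le> p ^ card W * overlap (card W)"
    using sum_meeting_le_overlap[OF finW] p_pos by (intro mult_left_mono) auto
  finally have 1: "(\<Sum>U\<in>(\<lambda>A. W \<union> A) ` ?M. p ^ card U) \<le> p ^ card W * overlap (card W)" .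
  have "(\<Sum>U\<in>(\<lambda>(A, B). W \<union> (A \<union> B)) ` ?P. p ^ card U) \<le> (\<Sum>(A, B)\<in>?P. p ^ card (W \<union> (A \<union> B)))"
    using sum_image_le[OF finP, of "\<lambda>U. p ^ card U" "\<lambda>(A, B). W \<union> (A \<union> B)"] p_pos
    by (simp add: comp_def split_def)
  also have "\<dots> = (\<Sum>(A, B)\<in>?P. p ^ card W * p ^ k * p ^ card (B - A))"
  proof (intro sum.cong refl)
    fix x assume "x \<in> ?P"
    then obtain A B where A: "x = (A, B)" "A \<in> E" "B \<in> E" "A \<inter> W = {}" "B \<inter> W = {}" by auto
    then have "A \<union> B - W = A \<union> B" by auto
    then show "(case x of (A, B) \<Rightarrow> p ^ card (W \<union> (A \<union> B))) =
      (case x of (A, B) \<Rightarrow> p ^ card W * p ^ k * p ^ card (B - A))"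
      using A card_Un[OF finW, of "A \<union> B"] card_Un[of A B] by (simp add: finite_edge edge_card power_add)
  qed
  also have "\<dots> \<le> (\<Sum>(A, B)\<in>?Q. p ^ card W * p ^ k * p ^ card (B - A))"
    using p_pos by (intro sum_mono2 finQ PQ) auto
  also have "\<dots> = (\<Sum>A\<in>E. p ^ card W * p ^ k * (\<Sum>B | B \<in> E \<and> B \<inter> A \<noteq> {} \<and> \<not> B \<subseteq> A. p ^ card (B - A)))"
    using finite_E by (subst sum.Sigma[symmetric]) (auto simp: sum_distrib_left)
  also have "\<dots> \<le> (\<Sum>A\<in>E. p ^ card W * p ^ k * overlap k)"
    using p_pos sum_meeting_le_overlap[OF finite_edge] edge_card by (intro sum_mono mult_left_mono) fastforce+
  also have "\<dots> = p ^ card W * (mean * overlap k)" by (simp add: mean_def)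
  finally have 2: "(\<Sum>U\<in>(\<lambda>(A, B). W \<union> (A \<union> B)) ` ?P. p ^ card U) \<le> p ^ card W * (mean * overlap k)" .
  have "(\<Sum>U\<in>grow W. p ^ card U) \<le> (\<Sum>U\<in>(\<lambda>A. W \<union> A) ` ?M. p ^ card U) +
      (\<Sum>U\<in>(\<lambda>(A, B). W \<union> (A \<union> B)) ` ?P. p ^ card U)"
    unfolding grow_def using finM finP p_pos by (intro sum_Un_le) auto
  then show ?thesis using 1 2 by (simp add: ring_distribs)
qed

lemma mean_nonneg: "0 \<le> mean"
  unfolding mean_def using p_pos by simp

text \<open>After at most \<open>m\<close> steps a cluster has at most \<open>2 * k * m\<close>
  points, so every step costs at most the same factor. Keeping \<open>m\<close> apart from
  \<open>j\<close> leaves this factor fixed during the induction.\<close>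

lemma sum_clusters_le:
  assumes "j \<le> m"
  shows "(\<Sum>W\<in>clusters j. p ^ card W) \<le> (overlap (2 * k * m) + mean * overlap k) ^ j"
  using assms
proof (induction j)
  case (Suc j)
  let ?\<eta> = "overlap (2 * k * m) + mean * overlap k"
  have "(\<Sum>W\<in>clusters (Suc j). p ^ card W) \<le> (\<Sum>W\<in>clusters j. \<Sum>U\<in>grow W. p ^ card U)"
    unfolding clusters.simps using p_pos
    by (intro sum_UN_le finite_clusters finite_grow clusters_subset) auto
  also have "\<dots> \<le> (\<Sum>W\<in>clusters j. p ^ card W * ?\<eta>)"
  proof (intro sum_mono)
    fix W assume W: "W \<in> clusters j"
    have "card W \<le> 2 * k * m" using card_cluster_le[OF W] Suc.prems
      by (meson Suc_leD le_trans mult_le_mono2)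
    then have "p ^ card W * (overlap (card W) + mean * overlap k) \<le> p ^ card W * ?\<eta>"
      using p_pos overlap_mono by (intro mult_left_mono) auto
    then show "(\<Sum>U\<in>grow W. p ^ card U) \<le> p ^ card W * ?\<eta>"
      using sum_grow_le[OF clusters_subset[OF W]] by simp
  qed
  also have "\<dots> = (\<Sum>W\<in>clusters j. p ^ card W) * ?\<eta>" by (simp add: sum_distrib_right)
  also have "\<dots> \<le> ?\<eta> ^ j * ?\<eta>"
    using Suc overlap_nonneg mean_nonneg by (intro mult_right_mono) auto
  finally show ?case by (simp only: power_Suc2)
qed simp

text \<open>A maximal cluster contains every crossing edge, so a cluster that is too small to contain all
  crossing edges can be grown.\<close>

lemma ex_cluster:
  assumes "finite S" "(2 * k * m)\<^sup>2 * D < card (crossing S)" "j \<le> m"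
  shows "\<exists>W\<in>clusters j. W \<subseteq> S"
  using assms(3)
proof (induction j)
  case (Suc j)
  then obtain W where W: "W \<in> clusters j" "W \<subseteq> S" by auto
  then have finW: "finite W" using assms finite_subset by auto
  have "card (edges_in W) \<le> card W ^ 2 * D" by (rule card_edges_in_le[OF finW])
  also have "\<dots> \<le> (2 * k * j) ^ 2 * D" using card_cluster_le[OF W(1)] by (intro mult_right_mono power_mono) auto
  also have "\<dots> \<le> (2 * k * m) ^ 2 * D" using Suc.prems by (intro mult_right_mono power_mono) auto
  finally have "card (edges_in W) < card (crossing S)" using assms by simp
  then have "\<not> crossing S \<subseteq> edges_in W" using card_mono[OF finite_edges_in, of "crossing S" W] by auto
  then obtain A B where AB: "A \<in> E" "B \<in> E" "A \<subseteq> S" "B \<subseteq> S" "B \<noteq> A" "A \<inter> B \<noteq> {}" "\<not> A \<subseteq> W"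
    by (auto simp: crossing_def edges_in_def)
  then have nBA: "\<not> B \<subseteq> A" using edge_subset_eq by blast
  \<comment> \<open>If \<open>A\<close> meets \<open>W\<close>, add \<open>A\<close>. If only
    \<open>B\<close> meets \<open>W\<close>, add \<open>B\<close>, which leaves \<open>W\<close> at
    a point of \<open>A\<close>. Otherwise add both.\<close>
  consider "A \<inter> W \<noteq> {}" | "A \<inter> W = {}" "B \<inter> W \<noteq> {}" | "A \<inter> W = {}" "B \<inter> W = {}" by blast
  then have "\<exists>U\<in>grow W. U \<subseteq> S"
  proof cases
    case 1
    then have "W \<union> A \<in> grow W" using AB by (auto simp: grow_def)
    then show ?thesis using AB W by (intro bexI[of _ "W \<union> A"]) simp_all
  next
    case 2
    then have "\<not> B \<subseteq> W" using AB by auto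
    then have "W \<union> B \<in> grow W" using AB 2 by (auto simp: grow_def)
    then show ?thesis using AB W by (intro bexI[of _ "W \<union> B"]) simp_all
  next
    case 3
    have "W \<union> (A \<union> B) \<in> grow W"
      unfolding grow_def using AB 3 nBA by (intro UnI2 image_eqI[where x = "(A, B)"]) auto
    then show ?thesis using AB W by (intro bexI[of _ "W \<union> (A \<union> B)"]) simp_all
  qed
  then show ?case using W by auto
qed auto

section \<open>First moment bounds and the upper tail\<close>

lemma prob_ex_subset_le:
  assumes "finite \<U>" "\<And>U. U \<in> \<U> \<Longrightarrow> U \<subseteq> V"
  shows "prob (\<lambda>S. \<exists>U\<in>\<U>. U \<subseteq> S) \<le> (\<Sum>U\<in>\<U>. p ^ card U)"
proof -
  have "prob (\<lambda>S. \<exists>U\<in>\<U>. U \<subseteq> S) \<le> bin_exp V p (\<lambda>S. \<Sum>U\<in>\<U>. of_bool (U \<subseteq> S))"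
    unfolding prob_def
  proof (intro bin_exp_mono)
    fix S :: "'a set"
    show "of_bool (\<exists>U\<in>\<U>. U \<subseteq> S) \<le> (\<Sum>U\<in>\<U>. of_bool (U \<subseteq> S) :: real)"
    proof (cases "\<exists>U\<in>\<U>. U \<subseteq> S")
      case True
      then obtain U where "U \<in> \<U>" "U \<subseteq> S" by auto
      then show ?thesis using member_le_sum[of U \<U> "\<lambda>U. of_bool (U \<subseteq> S) :: real"] assms(1) by auto
    qed (auto intro: sum_nonneg)
  qed (use p_pos p_less_1 in auto)
  also have "\<dots> = (\<Sum>U\<in>\<U>. p ^ card U)"
    unfolding bin_exp_sum using assms(2) finite_V by (intro sum.cong refl bin_exp_subset) auto
  finally show ?thesis .
qed

lemma prob_crossing_le:
  "prob (\<lambda>S. (2 * k * m)\<^sup>2 * D < card (crossing S)) \<le> (overlap (2 * k * m) + mean * overlap k) ^ m"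
proof -
  have "prob (\<lambda>S. (2 * k * m)\<^sup>2 * D < card (crossing S)) \<le> prob (\<lambda>S. \<exists>W\<in>clusters m. W \<subseteq> S)"
    by (intro prob_mono ex_cluster[OF finite_subset[OF _ finite_V]]) auto
  also have "\<dots> \<le> (\<Sum>W\<in>clusters m. p ^ card W)"
    using finite_clusters clusters_subset by (rule prob_ex_subset_le)
  also have "\<dots> \<le> (overlap (2 * k * m) + mean * overlap k) ^ m" by (rule sum_clusters_le) simp
  finally show ?thesis .
qed

text \<open>Markov's inequality for the number of matchings with \<open>l\<close> edges, of which there are at least
  \<open>n choose l\<close> on the event considered.\<close>

lemma prob_matching_le:
  assumes "l \<le> n"
  shows "prob (\<lambda>S. \<exists>F\<subseteq>edges_in S. card F = n \<and> disjoint F) \<le> mean ^ l / (fact l * real (n choose l))"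
proof -
  let ?M = "{F. F \<subseteq> E \<and> card F = l \<and> disjoint F}"
  have finM: "finite ?M" by (rule finite_subset[of _ "Pow E"]) (use finite_E in auto)
  have "(n choose l) * prob (\<lambda>S. \<exists>F\<subseteq>edges_in S. card F = n \<and> disjoint F)
      \<le> bin_exp V p (\<lambda>S. \<Sum>F\<in>?M. of_bool (\<Union>F \<subseteq> S))"
    unfolding prob_def bin_exp_cmult[symmetric]
  proof (intro bin_exp_mono)
    fix S :: "'a set"
    show "real (n choose l) * of_bool (\<exists>F\<subseteq>edges_in S. card F = n \<and> disjoint F)
      \<le> (\<Sum>F\<in>?M. of_bool (\<Union>F \<subseteq> S) :: real)"
    proof (cases "\<exists>F\<subseteq>edges_in S. card F = n \<and> disjoint F")
      case True
      then obtain F0 where F0: "F0 \<subseteq> edges_in S" "card F0 = n" "disjoint F0" by auto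
      then have "finite F0" using finite_edges_in finite_subset by blast
      then have "(n choose l) = card {F. F \<subseteq> F0 \<and> card F = l}" using n_subsets F0 by metis
      also have "\<dots> \<le> card {F \<in> ?M. \<Union>F \<subseteq> S}"
      proof (intro card_mono subsetI)
        show "finite {F \<in> ?M. \<Union>F \<subseteq> S}" by (rule finite_subset[OF _ finM]) auto
        fix F assume F: "F \<in> {F. F \<subseteq> F0 \<and> card F = l}"
        then have "disjoint F" using pairwise_subset[OF F0(3)] by simp
        moreover have "F \<subseteq> E" "\<Union>F \<subseteq> S" using F F0(1) unfolding edges_in_def by blast+
        ultimately show "F \<in> {F \<in> ?M. \<Union>F \<subseteq> S}" using F by simp
      qed
      also have "real \<dots> = (\<Sum>F\<in>?M. of_bool (\<Union>F \<subseteq> S))"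
        using finM by (simp add: of_bool_def sum.If_cases Int_def)
      finally show ?thesis using True by simp
    qed (auto intro: sum_nonneg)
  qed (use p_pos p_less_1 in auto)
  also have "\<dots> = (\<Sum>F\<in>?M. p ^ card (\<Union>F))"
    unfolding bin_exp_sum using finite_V edge_subset by (intro sum.cong refl bin_exp_subset) auto
  also have "\<dots> = (\<Sum>F\<in>?M. (p ^ k) ^ l)"
  proof (intro sum.cong refl)
    fix F assume F: "F \<in> ?M"
    then have "card (\<Union>F) = sum card F" using finite_edge by (intro card_Union_disjoint) auto
    also have "\<dots> = (\<Sum>A\<in>F. k)" using F edge_card by (intro sum.cong) auto
    finally show "p ^ card (\<Union>F) = (p ^ k) ^ l" using F by (simp add: power_mult mult.commute)
  qed
  also have "\<dots> = card ?M * (p ^ k) ^ l" by simp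
  also have "\<dots> \<le> (card E choose l) * (p ^ k) ^ l"
  proof (intro mult_right_mono of_nat_mono)
    have "card ?M \<le> card {F. F \<subseteq> E \<and> card F = l}"
      using finite_E by (intro card_mono) auto
    then show "card ?M \<le> (card E choose l)" using n_subsets[OF finite_E] by simp
  qed (use p_pos in auto)
  also have "\<dots> \<le> card E ^ l / fact l * (p ^ k) ^ l"
  proof (intro mult_right_mono)
    have "real ((card E choose l) * fact l) \<le> real (card E ^ l)"
      using binomial_fact_pow[of "card E" l] by (rule of_nat_mono)
    then show "real (card E choose l) \<le> real (card E ^ l) / fact l"
      by (simp add: field_simps)
  qed (use p_pos in auto)
  also have "\<dots> = mean ^ l / fact l" by (simp add: mean_def power_mult_distrib)
  finally show ?thesis using assms by (simp add: field_simps)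
qed

text \<open>When at most \<open>(2 * k * m)\<^sup>2 * D\<close> edges are crossing, discarding them
  leaves at least \<open>n\<close> pairwise disjoint edges. So the event forces a matching of size
  \<open>n\<close> or many crossing edges.\<close>

theorem prob_many_edges_le:
  fixes t :: real
  assumes "real n + (2 * k * m)\<^sup>2 * D \<le> t" "l \<le> n"
  shows "prob (\<lambda>S. t \<le> card (edges_in S)) \<le>
    mean ^ l / (fact l * real (n choose l)) + (overlap (2 * k * m) + mean * overlap k) ^ m"
proof -
  have "prob (\<lambda>S. t \<le> card (edges_in S)) \<le>
    prob (\<lambda>S. (\<exists>F\<subseteq>edges_in S. card F = n \<and> disjoint F) \<or> (2 * k * m)\<^sup>2 * D < card (crossing S))"
  proof (intro prob_mono)
    fix S assume S: "S \<subseteq> V" "t \<le> card (edges_in S)"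
    show "(\<exists>F\<subseteq>edges_in S. card F = n \<and> disjoint F) \<or> (2 * k * m)\<^sup>2 * D < card (crossing S)"
    proof (cases "(2 * k * m)\<^sup>2 * D < card (crossing S)")
      case False
      then have "n + card (crossing S) \<le> card (edges_in S)" using S assms by linarith
      moreover have "crossing S \<subseteq> edges_in S" by (auto simp: crossing_def)
      ultimately have "n \<le> card (edges_in S - crossing S)"
        using finite_edges_in[of S] finite_subset[of "crossing S" "edges_in S"]
        by (simp add: card_Diff_subset)
      then obtain F where F: "F \<subseteq> edges_in S - crossing S" "card F = n"
        using obtain_subset_with_card_n by metis
      then have "disjoint F" by (auto simp: pairwise_def disjnt_def crossing_def)
      then show ?thesis using F by blast
    qed auto
  qed
  also have "\<dots> \<le> mean ^ l / (fact l * real (n choose l)) + (overlap (2 * k * m) + mean * overlap k) ^ m"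
    using prob_disj_le prob_matching_le[OF assms(2)] prob_crossing_le[of m] by (meson add_mono order_trans)
  finally show ?thesis .
qed

section \<open>The lower tail estimate through exactly realised families\<close>

text \<open>Once the points of \<open>\<Union>F\<close> are present, every other edge
  \<open>B\<close> must miss a point of \<open>B - \<Union>F\<close>. These events are decreasing on
  \<open>V - \<Union>F\<close>, so Harris' inequality bounds their joint probability below by the
  product of the factors \<open>1 - p ^ card (B - \<Union>F)\<close>, which is then replaced by an
  exponential.\<close>

lemma prob_edges_eq_ge:
  assumes "F \<subseteq> E" "edges_in (\<Union>F) = F" "card (\<Union>F) \<le> u"
  shows "p ^ u * exp (- (mean + overlap u) / (1 - p)) \<le> prob (\<lambda>S. edges_in S = F)"
proof -
  let ?U = "\<Union>F"
  have UV: "?U \<subseteq> V" using assms edge_subset by auto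
  then have finU: "finite ?U" using finite_V finite_subset by auto
  have fin: "finite (E - F)" using finite_E by auto
  have nsub: "\<not> B \<subseteq> ?U" if "B \<in> E - F" for B
    using that assms(2) by (auto simp: edges_in_def)
  let ?x = "\<lambda>B. p ^ card (B - ?U)"
  \<comment> \<open>Edges disjoint from the union contribute at most \<open>mean\<close>, those
    meeting it at most its \<open>overlap\<close>.\<close>
  have "(\<Sum>B\<in>E - F. ?x B) \<le> (\<Sum>B\<in>{B \<in> E. B \<inter> ?U = {}} \<union> {B \<in> E. B \<inter> ?U \<noteq> {} \<and> \<not> B \<subseteq> ?U}. ?x B)"
    using finite_E nsub p_pos by (intro sum_mono2) auto
  also have "\<dots> = (\<Sum>B | B \<in> E \<and> B \<inter> ?U = {}. ?x B) + (\<Sum>B | B \<in> E \<and> B \<inter> ?U \<noteq> {} \<and> \<not> B \<subseteq> ?U. ?x B)"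
    using finite_E by (intro sum.union_disjoint) auto
  also have "\<dots> \<le> mean + overlap (card ?U)"
  proof (intro add_mono sum_meeting_le_overlap finU)
    have "(\<Sum>B | B \<in> E \<and> B \<inter> ?U = {}. ?x B) = (\<Sum>B | B \<in> E \<and> B \<inter> ?U = {}. p ^ k)"
      by (intro sum.cong) (auto simp: Diff_triv edge_card)
    also have "\<dots> \<le> (\<Sum>B\<in>E. p ^ k)" using finite_E p_pos by (intro sum_mono2) auto
    finally show "(\<Sum>B | B \<in> E \<and> B \<inter> ?U = {}. ?x B) \<le> mean" by (simp add: mean_def)
  qed
  also have "\<dots> \<le> mean + overlap u" using overlap_mono assms by simp
  finally have sum_le: "(\<Sum>B\<in>E - F. ?x B) \<le> mean + overlap u" .
  have xle: "?x B \<le> p" if "B \<in> E - F" for B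
  proof -
    have "B - ?U \<noteq> {}" "finite (B - ?U)" using nsub[OF that] finite_edge that by auto
    then have "1 \<le> card (B - ?U)" by (simp add: Suc_leI card_gt_0_iff)
    then show ?thesis using power_decreasing[of 1 "card (B - ?U)" p] p_pos p_less_1 by simp
  qed
  have "p ^ u * exp (- (mean + overlap u) / (1 - p)) \<le> p ^ card ?U * exp (\<Sum>B\<in>E - F. - ?x B / (1 - p))"
  proof (intro mult_mono power_decreasing)
    have "(\<Sum>B\<in>E - F. - ?x B / (1 - p)) = - (\<Sum>B\<in>E - F. ?x B) / (1 - p)"
      by (simp add: sum_divide_distrib sum_negf)
    then show "exp (- (mean + overlap u) / (1 - p)) \<le> exp (\<Sum>B\<in>E - F. - ?x B / (1 - p))"
      using sum_le p_less_1 by (simp only: exp_le_cancel_iff) (intro divide_right_mono, auto)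
  qed (use assms p_pos p_less_1 in auto)
  also have "\<dots> = p ^ card ?U * (\<Prod>B\<in>E - F. exp (- ?x B / (1 - p)))"
    using fin by (simp add: exp_sum)
  also have "\<dots> \<le> p ^ card ?U * (\<Prod>B\<in>E - F. 1 - ?x B)"
    using p_pos p_less_1 xle by (intro mult_left_mono prod_mono conjI exp_le_one_minus) auto
  also have "(\<Prod>B\<in>E - F. 1 - ?x B) = (\<Prod>B\<in>E - F. bin_exp (V - ?U) p (\<lambda>T. of_bool (\<not> B \<subseteq> ?U \<union> T)))"
  proof (intro prod.cong refl)
    fix B assume B: "B \<in> E - F"
    have "bin_exp (V - ?U) p (\<lambda>T. of_bool (\<not> B \<subseteq> ?U \<union> T)) =
       bin_exp (V - ?U) p (\<lambda>T. 1 - of_bool (B - ?U \<subseteq> T))"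
      by (intro bin_exp_cong) auto
    also have "\<dots> = 1 - ?x B"
      unfolding bin_exp_diff using finite_V B edge_subset[of B]
      by (subst bin_exp_subset) (auto simp: bin_exp_const)
    finally show "1 - ?x B = bin_exp (V - ?U) p (\<lambda>T. of_bool (\<not> B \<subseteq> ?U \<union> T))" by simp
  qed
  also have "p ^ card ?U * \<dots> \<le> p ^ card ?U * bin_exp (V - ?U) p (\<lambda>T. \<Prod>B\<in>E - F. of_bool (\<not> B \<subseteq> ?U \<union> T))"
    using p_pos p_less_1 finite_V by (intro mult_left_mono harris_inequality_prod fin) auto
  also have "\<dots> = bin_exp V p (\<lambda>S. of_bool (?U \<subseteq> S) * (\<Prod>B\<in>E - F. of_bool (\<not> B \<subseteq> S)))"
    using bin_exp_superset[OF finite_V UV, of p "\<lambda>S. \<Prod>B\<in>E - F. of_bool (\<not> B \<subseteq> S)"] by simp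
  also have "\<dots> \<le> prob (\<lambda>S. edges_in S = F)"
    unfolding prob_def
  proof (intro bin_exp_mono)
    fix S :: "'a set"
    show "of_bool (?U \<subseteq> S) * (\<Prod>B\<in>E - F. of_bool (\<not> B \<subseteq> S)) \<le> (of_bool (edges_in S = F) :: real)"
    proof (cases "?U \<subseteq> S \<and> (\<forall>B\<in>E - F. \<not> B \<subseteq> S)")
      case True
      then have "edges_in S = F" using assms by (auto simp: edges_in_def)
      then show ?thesis using True by simp
    next
      case False
      then have "of_bool (?U \<subseteq> S) * (\<Prod>B\<in>E - F. of_bool (\<not> B \<subseteq> S)) = (0 :: real)"
        using fin by (auto simp: prod_zero_iff)
      then show ?thesis by simp
    qed
  qed (use p_pos p_less_1 in auto)
  finally show ?thesis .
qed

text \<open>The families that can be the full set of edges in a random set: their union spans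
  nothing else. Distinct families give disjoint events.\<close>

definition exact_families :: "nat \<Rightarrow> 'a set set set" where
  "exact_families n = {F. F \<subseteq> E \<and> card F = n \<and> edges_in (\<Union>F) = F}"

text \<open>An upper bound for the number of edges by which an exact family of size \<open>n\<close>
  cannot be extended; the leading \<open>n\<close> stands for its own members.\<close>

definition bad_count :: "nat \<Rightarrow> nat" where
  "bad_count n = n + ((k * n)\<^sup>2 * D * (k * d) + k * n * d * (k\<^sup>2 * D))"

lemma card_Union_le:
  assumes "F \<subseteq> E"
  shows "card (\<Union>F) \<le> k * card F"
proof -
  have "finite F" using finite_E assms finite_subset by auto
  then have "card (\<Union>F) \<le> card F * k"
    using card_UN_le_mult[of F "\<lambda>A. A" k] assms edge_card by auto
  then show ?thesis by (simp add: mult.commute)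
qed

text \<open>If adding \<open>A\<close> to \<open>F\<close> completes a further edge \<open>B\<close>, then, as \<open>k \<ge> 3\<close>, \<open>B\<close> has two vertices
  in \<open>\<Union>F\<close> or two vertices in \<open>A\<close>; the two summands count these cases.\<close>

lemma card_bad_le:
  assumes "F \<in> exact_families n"
  shows "card {A \<in> E. A \<in> F \<or> edges_in (\<Union>(insert A F)) \<noteq> insert A F} \<le> bad_count n"
proof -
  let ?U = "\<Union>F"
  have F: "F \<subseteq> E" "card F = n" "edges_in ?U = F" using assms by (auto simp: exact_families_def)
  have finF: "finite F" using F finite_E finite_subset by auto
  have finU: "finite ?U" using F finF finite_edge by auto
  have cardU: "card ?U \<le> k * n" using card_Union_le F by auto
  let ?X = "\<Union>B\<in>{B \<in> E. 2 \<le> card (B \<inter> ?U)}. {A \<in> E. A \<inter> B \<noteq> {}}"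
  let ?Y = "\<Union>B\<in>{B \<in> E. B \<inter> ?U \<noteq> {}}. {A \<in> E. 2 \<le> card (A \<inter> B)}"
  have sub: "{A \<in> E. A \<in> F \<or> edges_in (\<Union>(insert A F)) \<noteq> insert A F} \<subseteq> F \<union> (?X \<union> ?Y)"
  proof
    fix A assume A: "A \<in> {A \<in> E. A \<in> F \<or> edges_in (\<Union>(insert A F)) \<noteq> insert A F}"
    show "A \<in> F \<union> (?X \<union> ?Y)"
    proof (cases "A \<in> F")
      case False
      have "insert A F \<subseteq> edges_in (\<Union>(insert A F))" using A F by (auto simp: edges_in_def)
      then obtain B where B: "B \<in> E" "B \<subseteq> A \<union> ?U" "B \<noteq> A" "B \<notin> F"
        using A False by (auto simp: edges_in_def)
      \<comment> \<open>Exactness of \<open>F\<close> keeps \<open>B\<close> from lying inside the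
        union, and uniformity keeps it from lying inside \<open>A\<close>; hence \<open>B\<close>
        meets both.\<close>
      have "\<not> B \<subseteq> ?U" using B F by (auto simp: edges_in_def)
      moreover have "\<not> B \<subseteq> A" using edge_subset_eq A B by blast
      ultimately have ne: "A \<inter> B \<noteq> {}" "B \<inter> ?U \<noteq> {}" using B by auto
      show ?thesis
      proof (cases "2 \<le> card (B \<inter> ?U)")
        case True
        then have "A \<in> ?X" using A B ne by blast
        then show ?thesis by blast
      next
        case False
        have "B \<subseteq> (A \<inter> B) \<union> (B \<inter> ?U)" using B by auto
        then have "card B \<le> card ((A \<inter> B) \<union> (B \<inter> ?U))"
          using finU finite_edge[OF B(1)] by (intro card_mono) auto
        also have "\<dots> \<le> card (A \<inter> B) + card (B \<inter> ?U)" by (rule card_Un_le)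
        finally have "2 \<le> card (A \<inter> B)" using False edge_card[OF B(1)] k_ge_3 by linarith
        then have "A \<in> ?Y" using A B ne by blast
        then show ?thesis by blast
      qed
    qed auto
  qed
  have X: "card ?X \<le> (k * n)\<^sup>2 * D * (k * d)"
  proof -
    have "card ?X \<le> card {B \<in> E. 2 \<le> card (B \<inter> ?U)} * (k * d)"
      using finite_E card_edges_meeting_le[OF finite_edge] edge_card
      by (intro card_UN_le_mult) fastforce+
    also have "card {B \<in> E. 2 \<le> card (B \<inter> ?U)} \<le> card ?U ^ 2 * D"
      by (rule card_edges_meeting_twice_le[OF finU])
    also have "card ?U ^ 2 \<le> (k * n)\<^sup>2" using cardU by (intro power_mono) auto
    finally show ?thesis by simp
  qed
  have Y: "card ?Y \<le> k * n * d * (k\<^sup>2 * D)"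
  proof -
    have "card ?Y \<le> card {B \<in> E. B \<inter> ?U \<noteq> {}} * (k\<^sup>2 * D)"
      using finite_E card_edges_meeting_twice_le[OF finite_edge] edge_card
      by (intro card_UN_le_mult) fastforce+
    also have "card {B \<in> E. B \<inter> ?U \<noteq> {}} \<le> card ?U * d"
      by (rule card_edges_meeting_le[OF finU])
    also have "card ?U \<le> k * n" by (rule cardU)
    finally show ?thesis by simp
  qed
  have "card {A \<in> E. A \<in> F \<or> edges_in (\<Union>(insert A F)) \<noteq> insert A F} \<le> card (F \<union> (?X \<union> ?Y))"
    using finite_E finF by (intro card_mono sub) auto
  also have "\<dots> \<le> card F + (card ?X + card ?Y)"
    by (meson card_Un_le add_le_mono le_refl order_trans)
  also have "\<dots> \<le> bad_count n" unfolding bad_count_def using X Y F by simp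
  finally show ?thesis .
qed

lemma finite_exact_families: "finite (exact_families n)"
  by (rule finite_subset[of _ "Pow E"]) (use finite_E in \<open>auto simp: exact_families_def\<close>)

text \<open>Double counting of the pairs of an exact family \<open>F\<close> of size
  \<open>n\<close> and an edge \<open>A\<close> extending it to an exact family. Each
  \<open>F\<close> has at least \<open>card E - bad_count n\<close> extensions, and each larger
  family arises by removing one of its \<open>Suc n\<close> members. If the truncated difference is
  0, the bound is trivial.\<close>

lemma card_exact_families_Suc:
  "card (exact_families n) * (card E - bad_count n) \<le> card (exact_families (Suc n)) * Suc n"
proof -
  let ?G = "\<lambda>F. {A \<in> E. A \<notin> F \<and> edges_in (\<Union>(insert A F)) = insert A F}"
  let ?B = "\<lambda>F. {A \<in> E. A \<in> F \<or> edges_in (\<Union>(insert A F)) \<noteq> insert A F}"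
  have "card E - bad_count n \<le> card (?G F)" if F: "F \<in> exact_families n" for F
  proof -
    have "?G F = E - ?B F" by auto
    then have "card (?G F) = card E - card (?B F)" using finite_E by (simp add: card_Diff_subset)
    then show ?thesis using card_bad_le[OF F] by simp
  qed
  then have "card (exact_families n) * (card E - bad_count n) \<le> (\<Sum>F\<in>exact_families n. card (?G F))"
    using sum_bounded_below[of "exact_families n" "card E - bad_count n" "\<lambda>F. card (?G F)"] by simp
  also have "\<dots> = card (Sigma (exact_families n) ?G)"
    using finite_exact_families finite_E by (subst card_SigmaI) auto
  also have "\<dots> \<le> card (Sigma (exact_families (Suc n)) (\<lambda>F. F))"
  proof (rule card_inj_on_le)
    show "inj_on (\<lambda>(F, A). (insert A F, A)) (Sigma (exact_families n) ?G)"
    proof (rule inj_onI)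
      fix x y
      assume "x \<in> Sigma (exact_families n) ?G" "y \<in> Sigma (exact_families n) ?G"
        and eq: "(case x of (F, A) \<Rightarrow> (insert A F, A)) = (case y of (F, A) \<Rightarrow> (insert A F, A))"
      then obtain F F' A A' where "x = (F, A)" "y = (F', A')" "A \<notin> F" "A' \<notin> F'" by blast
      with eq show "x = y" by (auto simp: insert_ident)
    qed
    show "(\<lambda>(F, A). (insert A F, A)) ` Sigma (exact_families n) ?G \<subseteq> Sigma (exact_families (Suc n)) (\<lambda>F. F)"
    proof (rule image_subsetI)
      fix x assume "x \<in> Sigma (exact_families n) ?G"
      then obtain F A where FA: "x = (F, A)" "F \<in> exact_families n" "A \<in> E" "A \<notin> F"
        "edges_in (\<Union>(insert A F)) = insert A F" by blast
      then have "finite F" using finite_E finite_subset by (auto simp: exact_families_def)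
      then show "(case x of (F, A) \<Rightarrow> (insert A F, A)) \<in> Sigma (exact_families (Suc n)) (\<lambda>F. F)"
        using FA by (auto simp: exact_families_def)
    qed
    show "finite (Sigma (exact_families (Suc n)) (\<lambda>F. F))"
      using finite_exact_families finite_E finite_subset
      by (intro finite_SigmaI) (auto simp: exact_families_def)
  qed
  also have "\<dots> = (\<Sum>F\<in>exact_families (Suc n). card F)"
    using finite_exact_families finite_E finite_subset
    by (subst card_SigmaI) (auto simp: exact_families_def)
  also have "\<dots> = card (exact_families (Suc n)) * Suc n"
    by (simp add: exact_families_def)
  finally show ?thesis .
qed

text \<open>Iterate the extension step; the factors \<open>Suc n\<close> build up the factorial. As
  \<open>bad_count\<close> is increasing, its value at \<open>m\<close> serves for all
  steps.\<close>

lemma card_exact_families_ge: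
  assumes "n \<le> m"
  shows "(card E - bad_count m) ^ n \<le> card (exact_families n) * fact n"
  using assms
proof (induction n)
  case 0
  \<comment> \<open>The empty union spans no edge, since edges have at least three points.\<close>
  have "{} \<in> exact_families 0" using edge_card k_ge_3 by (force simp: exact_families_def edges_in_def)
  then have "0 < card (exact_families 0)" using finite_exact_families card_gt_0_iff by blast
  then show ?case by simp
next
  case (Suc n)
  have "bad_count n \<le> bad_count m"
    unfolding bad_count_def using Suc.prems by (intro add_mono mult_le_mono power_mono) auto
  then have "(card E - bad_count m) ^ Suc n \<le> (card (exact_families n) * fact n) * (card E - bad_count n)"
    using Suc by (simp only: power_Suc2, intro mult_le_mono) auto
  also have "\<dots> \<le> (card (exact_families (Suc n)) * Suc n) * fact n"
    using card_exact_families_Suc[of n] by (simp add: mult.commute mult.left_commute)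
  also have "\<dots> = card (exact_families (Suc n)) * fact (Suc n)" by (simp add: algebra_simps)
  finally show ?case .
qed

text \<open>Sum the bound of \<open>prob_edges_eq_ge\<close> over all exact families of size
  \<open>n\<close>. The union of such a family has at most \<open>k * n\<close> points.\<close>

theorem prob_many_edges_ge:
  "real (card E - bad_count n) ^ n / fact n * (p ^ k) ^ n * exp (- (mean + overlap (k * n)) / (1 - p))
     \<le> prob (\<lambda>S. n \<le> card (edges_in S))"
proof -
  let ?c = "(p ^ k) ^ n * exp (- (mean + overlap (k * n)) / (1 - p))"
  have "real ((card E - bad_count n) ^ n) \<le> real (card (exact_families n) * fact n)"
    using card_exact_families_ge[of n n] by (intro of_nat_mono) simp
  then have "real (card E - bad_count n) ^ n / fact n \<le> card (exact_families n)"
    by (simp add: field_simps)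
  then have "real (card E - bad_count n) ^ n / fact n * ?c \<le> card (exact_families n) * ?c"
    using p_pos by (intro mult_right_mono) auto
  also have "\<dots> = (\<Sum>F\<in>exact_families n. ?c)" by simp
  also have "\<dots> \<le> (\<Sum>F\<in>exact_families n. prob (\<lambda>S. edges_in S = F))"
    using prob_edges_eq_ge[of _ "k * n"] card_Union_le
    by (intro sum_mono) (auto simp: exact_families_def power_mult)
  also have "\<dots> = bin_exp V p (\<lambda>S. \<Sum>F\<in>exact_families n. of_bool (edges_in S = F))"
    unfolding prob_def bin_exp_sum ..
  also have "\<dots> \<le> prob (\<lambda>S. n \<le> card (edges_in S))"
    unfolding prob_def
  proof (intro bin_exp_mono)
    fix S :: "'a set"
    have "(\<Sum>F\<in>exact_families n. of_bool (edges_in S = F) :: real) = of_bool (edges_in S \<in> exact_families n)"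
      using finite_exact_families by (simp add: of_bool_def sum.delta')
    also have "\<dots> \<le> of_bool (n \<le> card (edges_in S))" by (auto simp: exact_families_def)
    finally show "(\<Sum>F\<in>exact_families n. of_bool (edges_in S = F) :: real) \<le> of_bool (n \<le> card (edges_in S))" .
  qed (use p_pos p_less_1 in auto)
  finally show ?thesis by (simp add: mult.assoc)
qed

end

section \<open>The hypergraph of arithmetic progressions\<close>

text \<open>Progressions as edges of a hypergraph. Positive differences make the lists strictly
  increasing, so passing to sets loses nothing.\<close>

definition AP_sets :: "nat \<Rightarrow> nat \<Rightarrow> int set set" where
  "AP_sets k N = set ` {xs. is_AP k xs \<and> set xs \<subseteq> {1..int N}}"

lemma mem_AP_sets_iff:
  "A \<in> AP_sets k N \<longleftrightarrow> (\<exists>a b. b > 0 \<and> A = (\<lambda>i. a + int i * b) ` {..<k} \<and> A \<subseteq> {1..int N})"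
  by (fastforce simp: AP_sets_def is_AP_def image_iff atLeast0LessThan)

lemma is_AP_sorted_distinct: "is_AP k xs \<Longrightarrow> sorted xs \<and> distinct xs"
  by (auto simp: is_AP_def distinct_map inj_on_def sorted_iff_nth_mono)

lemma inj_on_set_AP: "inj_on set {xs. is_AP k xs \<and> set xs \<subseteq> S}"
  by (rule inj_onI, rule sorted_distinct_set_unique) (use is_AP_sorted_distinct in auto)

lemma AP_count_eq:
  assumes "S \<subseteq> {1..int N}"
  shows "AP_count k S = card {A \<in> AP_sets k N. A \<subseteq> S}"
proof -
  have "{A \<in> AP_sets k N. A \<subseteq> S} = set ` {xs. is_AP k xs \<and> set xs \<subseteq> S}"
    using assms by (auto simp: AP_sets_def)
  then show ?thesis using card_image[OF inj_on_set_AP, of k S] by (simp add: AP_count_def)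
qed

lemma card_AP_set:
  assumes "A \<in> AP_sets k N"
  shows "card A = k"
proof -
  obtain a b where "b > 0" "A = (\<lambda>i. a + int i * b) ` {..<k}" using assms by (auto simp: mem_AP_sets_iff)
  then show ?thesis by (simp add: card_image inj_on_def)
qed

lemma AP_difference_bounds:
  assumes "2 \<le> k" "b > 0" "(\<lambda>i. a + int i * b) ` {..<k} \<subseteq> {1..int N}"
  shows "a \<in> {1..int N}" "b \<in> {1..int N}"
proof -
  have "a + int 0 * b \<in> {1..int N}" "a + int 1 * b \<in> {1..int N}"
    using assms by (auto simp del: atLeastAtMost_iff intro!: subsetD[OF assms(3)] imageI)
  then show "a \<in> {1..int N}" "b \<in> {1..int N}" using assms by auto
qed

text \<open>A progression through \<open>v\<close> is determined by the position of \<open>v\<close>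
  in it and by its difference.\<close>

lemma AP_degree_le:
  assumes "2 \<le> k"
  shows "card {A \<in> AP_sets k N. v \<in> A} \<le> k * N"
proof -
  let ?f = "\<lambda>(i, b). (\<lambda>j. v + (int j - int i) * b) ` {..<k}"
  have "{A \<in> AP_sets k N. v \<in> A} \<subseteq> ?f ` ({..<k} \<times> {1..int N})"
  proof
    fix A assume "A \<in> {A \<in> AP_sets k N. v \<in> A}"
    then obtain a b i where A: "b > 0" "A = (\<lambda>i. a + int i * b) ` {..<k}" "A \<subseteq> {1..int N}"
      "i < k" "v = a + int i * b" by (auto simp: mem_AP_sets_iff)
    then have "A = ?f (i, b)" by (auto simp: algebra_simps)
    moreover have "b \<in> {1..int N}" using AP_difference_bounds[of k b a N] A assms by auto
    ultimately show "A \<in> ?f ` ({..<k} \<times> {1..int N})" using A by blast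
  qed
  then have "card {A \<in> AP_sets k N. v \<in> A} \<le> card ({..<k} \<times> {1..int N})"
    by (rule surj_card_le[rotated]) simp
  then show ?thesis by simp
qed

text \<open>The positions \<open>i\<close>, \<open>j\<close> of the two points determine the
  difference as the exact quotient of \<open>w - v\<close> by \<open>j - i\<close>, and thus the
  progression.\<close>

lemma AP_codegree_le:
  assumes "v \<noteq> w"
  shows "card {A \<in> AP_sets k N. v \<in> A \<and> w \<in> A} \<le> k\<^sup>2"
proof -
  let ?f = "\<lambda>(i, j). (\<lambda>l. v + (int l - int i) * ((w - v) div (int j - int i))) ` {..<k}"
  have "{A \<in> AP_sets k N. v \<in> A \<and> w \<in> A} \<subseteq> ?f ` ({..<k} \<times> {..<k})"
  proof
    fix A assume "A \<in> {A \<in> AP_sets k N. v \<in> A \<and> w \<in> A}"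
    then obtain a b i j where A: "b > 0" "A = (\<lambda>i. a + int i * b) ` {..<k}"
      "i < k" "v = a + int i * b" "j < k" "w = a + int j * b" by (auto simp: mem_AP_sets_iff)
    then have "w - v = (int j - int i) * b" "int j - int i \<noteq> 0" using assms by (auto simp: algebra_simps)
    then have "(w - v) div (int j - int i) = b" by simp
    then have "A = ?f (i, j)" using A by (auto simp: algebra_simps)
    then show "A \<in> ?f ` ({..<k} \<times> {..<k})" using A by blast
  qed
  then have "card {A \<in> AP_sets k N. v \<in> A \<and> w \<in> A} \<le> card ({..<k} \<times> {..<k})"
    by (rule surj_card_le[rotated]) simp
  then show ?thesis by (simp add: power2_eq_square)
qed

lemma sparse_hypergraph_AP_sets:
  assumes "3 \<le> k" "0 < p" "p < 1"
  shows "sparse_hypergraph {1..int N} (AP_sets k N) k (k * N) (k\<^sup>2) p"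
proof
  show "A \<subseteq> {1..int N}" if "A \<in> AP_sets k N" for A using that by (auto simp: AP_sets_def)
qed (use assms in \<open>auto intro: card_AP_set AP_degree_le AP_codegree_le\<close>)

lemma card_AP_sets_le:
  assumes "2 \<le> k"
  shows "card (AP_sets k N) \<le> N\<^sup>2"
proof -
  have "AP_sets k N \<subseteq> (\<lambda>(a, b). (\<lambda>i. a + int i * b) ` {..<k}) ` ({1..int N} \<times> {1..int N})"
  proof
    fix A assume "A \<in> AP_sets k N"
    then obtain a b where "b > 0" "A = (\<lambda>i. a + int i * b) ` {..<k}" "A \<subseteq> {1..int N}"
      by (auto simp: mem_AP_sets_iff)
    moreover then have "a \<in> {1..int N}" "b \<in> {1..int N}"
      using AP_difference_bounds[of k b a N] assms by auto
    ultimately show "A \<in> (\<lambda>(a, b). (\<lambda>i. a + int i * b) ` {..<k}) ` ({1..int N} \<times> {1..int N})" by blast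
  qed
  then have "card (AP_sets k N) \<le> card ({1..int N} \<times> {1..int N})"
    by (rule surj_card_le[rotated]) simp
  then show ?thesis by (simp add: power2_eq_square)
qed

text \<open>Every first term up to \<open>N div 2\<close> together with every difference up to
  \<open>N div (2 * k)\<close> gives a progression in [N]. Each of the two floors loses at most a
  factor 2, hence the constant 16.\<close>

lemma card_AP_sets_ge:
  assumes "2 \<le> k" "2 * k \<le> N"
  shows "(real N)\<^sup>2 / (16 * k) \<le> card (AP_sets k N)"
proof -
  let ?g = "\<lambda>(a, b). map (\<lambda>i. a + int i * b) [0..<k]"
  let ?P = "{1..int (N div 2)} \<times> {1..int (N div (2 * k))}"
  have inj: "inj_on ?g ?P"
  proof (rule inj_onI, clarify)
    fix a b a' b' assume eq: "map (\<lambda>i. a + int i * b) [0..<k] = map (\<lambda>i. a' + int i * b') [0..<k]"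
    have "map (\<lambda>i. a + int i * b) [0..<k] ! i = map (\<lambda>i. a' + int i * b') [0..<k] ! i" for i
      by (simp only: eq)
    from this[of 0] this[of 1] show "a = a' \<and> b = b'" using assms by simp
  qed
  have sub: "?g ` ?P \<subseteq> {xs. is_AP k xs \<and> set xs \<subseteq> {1..int N}}"
  proof (rule image_subsetI)
    fix x assume "x \<in> ?P"
    then obtain a b where x: "x = (a, b)"
      and ab: "a \<in> {1..int (N div 2)}" "b \<in> {1..int (N div (2 * k))}" by auto
    have "a + int i * b \<in> {1..int N}" if i: "i < k" for i
    proof -
      have "int i * b \<le> int k * int (N div (2 * k))" using i ab by (intro mult_mono) auto
      also have "\<dots> \<le> int (N div 2)"
      proof -
        have "k * (N div (2 * k)) \<le> N div 2"
          by (simp add: div_mult2_eq)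
        then show ?thesis by (metis of_nat_le_iff of_nat_mult)
      qed
      finally have "a + int i * b \<le> int (N div 2) + int (N div 2)" using ab by simp
      also have "\<dots> \<le> int N" by linarith
      finally show ?thesis using ab by (auto intro: add_increasing2)
    qed
    moreover have "is_AP k (?g (a, b))"
      unfolding is_AP_def using ab by (intro exI[of _ a] exI[of _ b]) auto
    ultimately show "?g x \<in> {xs. is_AP k xs \<and> set xs \<subseteq> {1..int N}}" by (auto simp: x)
  qed
  have "finite (AP_sets k N)"
    by (rule finite_subset[of _ "Pow {1..int N}"]) (auto simp: AP_sets_def)
  then have fin: "finite {xs. is_AP k xs \<and> set xs \<subseteq> {1..int N}}"
    unfolding AP_sets_def using inj_on_set_AP finite_imageD by blast
  have "(N div 2) * (N div (2 * k)) = card ?P" by simp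
  also have "\<dots> \<le> card {xs. is_AP k xs \<and> set xs \<subseteq> {1..int N}}"
    using inj sub fin by (rule card_inj_on_le)
  also have "\<dots> = card (AP_sets k N)"
    unfolding AP_sets_def using card_image[OF inj_on_set_AP] by metis
  finally have *: "real (N div 2) * real (N div (2 * k)) \<le> card (AP_sets k N)"
    by (metis of_nat_le_iff of_nat_mult)
  have half: "real N / (2 * real c) \<le> real (N div c)" if "c \<le> N" "0 < c" for c :: nat
  proof -
    have "1 * c \<le> N div c * c" using that by (intro mult_right_mono) (auto simp: Suc_le_eq div_greater_zero_iff)
    moreover have "N mod c < c" using that by simp
    ultimately have "N \<le> 2 * (N div c * c)" using div_mult_mod_eq[of N c] by linarith
    then have "real N \<le> 2 * (real (N div c) * real c)" by (metis of_nat_le_iff of_nat_mult of_nat_numeral)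
    then show ?thesis using that by (simp add: field_simps)
  qed
  have "(real N)\<^sup>2 / (16 * k) = (real N / (2 * real 2)) * (real N / (2 * real (2 * k)))"
    by (simp add: power2_eq_square)
  also have "\<dots> \<le> real (N div 2) * real (N div (2 * k))"
    using assms by (intro mult_mono half) auto
  finally show ?thesis using * by simp
qed

section \<open>The tail bounds for progressions\<close>

text \<open>The value of \<open>overlap\<close> for progressions, stated outside the locale so that
  \<open>N\<close> and \<open>p\<close> may vary in the asymptotics.\<close>

definition AP_overlap :: "nat \<Rightarrow> nat \<Rightarrow> real \<Rightarrow> nat \<Rightarrow> real" where
  "AP_overlap k N p u = u * (k * N) * p ^ (k - 1) + u ^ 2 * k\<^sup>2 * p"

lemma AP_mean_eq:
  fixes p :: real
  assumes "3 \<le> k" "0 < p" "p < 1"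
  shows "AP_mean k N p = card (AP_sets k N) * p ^ k"
proof -
  interpret sparse_hypergraph "{1..int N}" "AP_sets k N" k "k * N" "k\<^sup>2" p
    using assms by (rule sparse_hypergraph_AP_sets)
  have "AP_mean k N p = bin_exp {1..int N} p (\<lambda>S. real (AP_count k S))"
    unfolding AP_mean_def using assms by (simp add: expectation_binomial_random_set)
  also have "\<dots> = bin_exp {1..int N} p (\<lambda>S. \<Sum>A\<in>AP_sets k N. of_bool (A \<subseteq> S))"
    using finite_E by (intro bin_exp_cong) (simp add: AP_count_eq of_bool_def sum.If_cases Int_def)
  also have "\<dots> = (\<Sum>A\<in>AP_sets k N. p ^ card A)"
    unfolding bin_exp_sum using finite_V edge_subset by (intro sum.cong refl bin_exp_subset) auto
  also have "\<dots> = (\<Sum>A\<in>AP_sets k N. p ^ k)" by (intro sum.cong) (auto simp: edge_card)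
  finally show ?thesis by simp
qed

lemma AP_upper_tail_le:
  assumes "3 \<le> k" "0 < p" "p < 1" "l \<le> n"
    and "real n + (2 * k * m)\<^sup>2 * k\<^sup>2 \<le> (1 + \<delta>) * AP_mean k N p"
  shows "AP_upper_tail k N p \<delta> \<le> AP_mean k N p ^ l / (fact l * real (n choose l)) +
    (AP_overlap k N p (2 * k * m) + AP_mean k N p * AP_overlap k N p k) ^ m"
proof -
  interpret sparse_hypergraph "{1..int N}" "AP_sets k N" k "k * N" "k\<^sup>2" p
    using assms(1-3) by (rule sparse_hypergraph_AP_sets)
  have m: "mean = AP_mean k N p" using AP_mean_eq assms by (simp add: mean_def)
  have o: "overlap = AP_overlap k N p" by (simp add: fun_eq_iff overlap_def AP_overlap_def)
  have "AP_upper_tail k N p \<delta> = prob (\<lambda>S. (1 + \<delta>) * AP_mean k N p \<le> card (edges_in S))"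
    unfolding AP_upper_tail_def prob_def using assms
    by (simp add: prob_binomial_random_set) (intro bin_exp_cong, simp add: AP_count_eq edges_in_def)
  then show ?thesis
    using prob_many_edges_le[of n m "(1 + \<delta>) * AP_mean k N p" l] assms(4,5) by (simp add: m o)
qed

definition AP_bad_count :: "nat \<Rightarrow> nat \<Rightarrow> nat \<Rightarrow> nat" where
  "AP_bad_count k N n = n + ((k * n)\<^sup>2 * k\<^sup>2 * (k * (k * N)) + k * n * (k * N) * (k\<^sup>2 * k\<^sup>2))"

lemma AP_upper_tail_ge:
  assumes "3 \<le> k" "0 < p" "p < 1" "(1 + \<delta>) * AP_mean k N p \<le> n"
  shows "real (card (AP_sets k N) - AP_bad_count k N n) ^ n / fact n * (p ^ k) ^ n *
    exp (- (AP_mean k N p + AP_overlap k N p (k * n)) / (1 - p)) \<le> AP_upper_tail k N p \<delta>"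
proof -
  interpret sparse_hypergraph "{1..int N}" "AP_sets k N" k "k * N" "k\<^sup>2" p
    using assms(1-3) by (rule sparse_hypergraph_AP_sets)
  have m: "mean = AP_mean k N p" using AP_mean_eq assms by (simp add: mean_def)
  have o: "overlap = AP_overlap k N p" by (simp add: fun_eq_iff overlap_def AP_overlap_def)
  have b: "bad_count = AP_bad_count k N" by (simp add: fun_eq_iff bad_count_def AP_bad_count_def)
  have "prob (\<lambda>S. n \<le> card (edges_in S)) \<le> prob (\<lambda>S. (1 + \<delta>) * AP_mean k N p \<le> card (edges_in S))"
    using assms(4) by (intro prob_mono) linarith
  also have "\<dots> = AP_upper_tail k N p \<delta>"
    unfolding AP_upper_tail_def prob_def using assms
    by (simp add: prob_binomial_random_set) (intro bin_exp_cong, simp add: AP_count_eq edges_in_def)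
  finally show ?thesis using prob_many_edges_ge[of n] by (simp add: m o b)
qed

section \<open>Asymptotics of factorials\<close>

text \<open>Induction on \<open>n\<close>; the increment is controlled by
  \<open>ln ((1 + n) / n) \<le> 1 / n\<close>.\<close>

lemma ln_fact_ge: "real n * ln n - n \<le> ln (fact n)"
proof (induction n)
  case (Suc n)
  show ?case
  proof (cases "n = 0")
    case False
    have "ln ((1 + real n) / n) \<le> (1 + real n) / n - 1" using False by (intro ln_le_minus_one) auto
    then have "real n * (ln (1 + real n) - ln n) \<le> 1"
      using False by (simp add: ln_div field_simps)
    then have "real (Suc n) * ln (Suc n) - Suc n \<le> ln (Suc n) + (real n * ln n - n)"
      by (simp add: algebra_simps)
    also have "\<dots> \<le> ln (Suc n) + ln (fact n)" using Suc by simp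
    also have "\<dots> = ln (fact (Suc n))" by (simp add: ln_mult)
    finally show ?thesis .
  qed auto
qed auto

text \<open>The same induction with \<open>ln (n / (1 + n)) \<le> - 1 / (1 + n)\<close>. The excess
  \<open>ln n + 1\<close> is negligible against \<open>n\<close>.\<close>

lemma ln_fact_le: "1 \<le> n \<Longrightarrow> ln (fact n) \<le> real n * ln n - n + ln n + 1"
proof (induction n rule: dec_induct)
  case (step n)
  have "ln (real n / (1 + real n)) \<le> real n / (1 + real n) - 1"
    using step by (intro ln_le_minus_one) auto
  then have "1 \<le> (1 + real n) * (ln (1 + real n) - ln n)"
    using step by (simp add: ln_div field_simps)
  then have "ln (Suc n) + (real n * ln n - n + ln n + 1) \<le> real (Suc n) * ln (Suc n) - Suc n + ln (Suc n) + 1"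
    by (simp add: algebra_simps)
  moreover have "ln (fact (Suc n) :: real) = ln (Suc n) + ln (fact n)" by (simp add: ln_mult)
  ultimately show ?case using step by linarith
qed auto

text \<open>By the two factorial bounds the left side is
  \<open>(f / \<mu>) * ln (f / \<mu>) - f / \<mu>\<close> up to a vanishing error. The subtracted
  multiple of \<open>ln \<mu>\<close> is the divergent part; in both applications it cancels against
  a power of \<mu>.\<close>

lemma tendsto_ln_fact_div:
  fixes f :: "nat \<Rightarrow> nat" and \<mu> :: "nat \<Rightarrow> real"
  assumes \<mu>: "filterlim \<mu> at_top sequentially" and f: "(\<lambda>N. f N / \<mu> N) \<longlonglongrightarrow> \<alpha>" and "0 < \<alpha>"
  shows "(\<lambda>N. ln (fact (f N)) / \<mu> N - (f N / \<mu> N) * ln (\<mu> N)) \<longlonglongrightarrow> \<alpha> * ln \<alpha> - \<alpha>"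
proof -
  have \<mu>_pos: "\<forall>\<^sub>F N in sequentially. 0 < \<mu> N" using \<mu> by (simp add: filterlim_at_top_dense)
  have ratio_pos: "\<forall>\<^sub>F N in sequentially. 0 < f N / \<mu> N" using order_tendstoD(1)[OF f] assms by auto
  have f_pos: "\<forall>\<^sub>F N in sequentially. 1 \<le> f N"
    using \<mu>_pos ratio_pos by eventually_elim (auto simp: Suc_le_eq zero_less_divide_iff)
  let ?g = "\<lambda>N. (f N / \<mu> N) * ln (f N / \<mu> N) - f N / \<mu> N"
  have lim_g: "?g \<longlonglongrightarrow> \<alpha> * ln \<alpha> - \<alpha>" using assms by (intro tendsto_intros) auto
  have "(\<lambda>N. ln (\<mu> N) / \<mu> N) \<longlonglongrightarrow> 0" using \<mu> by (rule filterlim_compose[OF ln_x_over_x_tendsto_0])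
  moreover have inv: "(\<lambda>N. 1 / \<mu> N) \<longlonglongrightarrow> 0"
    using tendsto_inverse_0_at_top[OF \<mu>] by (simp add: inverse_eq_divide)
  moreover have "(\<lambda>N. ln (f N / \<mu> N)) \<longlonglongrightarrow> ln \<alpha>" using assms by (intro tendsto_intros) auto
  ultimately have "(\<lambda>N. ?g N + (ln (f N / \<mu> N) * (1 / \<mu> N) + ln (\<mu> N) / \<mu> N + 1 / \<mu> N))
      \<longlonglongrightarrow> (\<alpha> * ln \<alpha> - \<alpha>) + (ln \<alpha> * 0 + 0 + 0)"
    using lim_g by (intro tendsto_add tendsto_mult) auto
  then have lim_h: "(\<lambda>N. ?g N + (ln (f N / \<mu> N) * (1 / \<mu> N) + ln (\<mu> N) / \<mu> N + 1 / \<mu> N)) \<longlonglongrightarrow> \<alpha> * ln \<alpha> - \<alpha>"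
    by simp
  have eq: "\<forall>\<^sub>F N in sequentially. ln (f N) = ln (f N / \<mu> N) + ln (\<mu> N)"
    using \<mu>_pos f_pos by eventually_elim (simp add: ln_div)
  show ?thesis
  proof (rule tendsto_sandwich[OF _ _ lim_g lim_h])
    show "\<forall>\<^sub>F N in sequentially. ?g N \<le> ln (fact (f N)) / \<mu> N - (f N / \<mu> N) * ln (\<mu> N)"
      using \<mu>_pos eq
    proof eventually_elim
      case (elim N)
      have "(f N * ln (f N) - f N) / \<mu> N \<le> ln (fact (f N)) / \<mu> N"
        using ln_fact_ge[of "f N"] elim by (intro divide_right_mono) auto
      then show ?case unfolding elim(2) by (simp add: diff_divide_distrib add_divide_distrib algebra_simps)
    qed
    show "\<forall>\<^sub>F N in sequentially. ln (fact (f N)) / \<mu> N - (f N / \<mu> N) * ln (\<mu> N) \<le>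
       ?g N + (ln (f N / \<mu> N) * (1 / \<mu> N) + ln (\<mu> N) / \<mu> N + 1 / \<mu> N)"
      using \<mu>_pos eq f_pos
    proof eventually_elim
      case (elim N)
      have "ln (fact (f N)) / \<mu> N \<le> (f N * ln (f N) - f N + ln (f N) + 1) / \<mu> N"
        using ln_fact_le[of "f N"] elim by (intro divide_right_mono) auto
      then show ?case unfolding elim(2) by (simp add: diff_divide_distrib add_divide_distrib algebra_simps)
    qed
  qed
qed

lemma tendsto_div_of_near:
  fixes f :: "nat \<Rightarrow> nat" and \<mu> :: "nat \<Rightarrow> real"
  assumes "filterlim \<mu> at_top sequentially"
    and "\<forall>\<^sub>F N in sequentially. \<bar>f N - c * \<mu> N\<bar> \<le> 1"
  shows "(\<lambda>N. f N / \<mu> N) \<longlonglongrightarrow> c"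
proof -
  have "(\<lambda>N. f N / \<mu> N - c) \<longlonglongrightarrow> 0"
  proof (rule Lim_null_comparison)
    have "\<forall>\<^sub>F N in sequentially. 0 < \<mu> N" using assms(1) by (simp add: filterlim_at_top_dense)
    with assms(2) show "\<forall>\<^sub>F N in sequentially. norm (f N / \<mu> N - c) \<le> 1 / \<mu> N"
    proof eventually_elim
      case (elim N)
      then have "f N / \<mu> N - c = (f N - c * \<mu> N) / \<mu> N" by (simp add: field_simps)
      then show ?case using elim by (simp add: divide_right_mono)
    qed
    show "(\<lambda>N. 1 / \<mu> N) \<longlonglongrightarrow> 0"
      using tendsto_inverse_0_at_top[OF assms(1)] by (simp add: inverse_eq_divide)
  qed
  then show ?thesis by (simp add: LIM_zero_iff)
qed

lemma tendsto_nat_floor_div: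
  assumes "filterlim \<mu> at_top sequentially" "0 \<le> c"
  shows "(\<lambda>N. real (nat \<lfloor>c * \<mu> N\<rfloor>) / \<mu> N) \<longlonglongrightarrow> c"
proof (rule tendsto_div_of_near[OF assms(1)])
  have "\<forall>\<^sub>F N in sequentially. 0 < \<mu> N" using assms(1) by (simp add: filterlim_at_top_dense)
  then show "\<forall>\<^sub>F N in sequentially. \<bar>real (nat \<lfloor>c * \<mu> N\<rfloor>) - c * \<mu> N\<bar> \<le> 1"
  proof eventually_elim
    case (elim N)
    then have "0 \<le> c * \<mu> N" using assms(2) by simp
    then show ?case by linarith
  qed
qed

lemma tendsto_nat_ceiling_div:
  assumes "filterlim \<mu> at_top sequentially" "0 \<le> c"
  shows "(\<lambda>N. real (nat \<lceil>c * \<mu> N\<rceil>) / \<mu> N) \<longlonglongrightarrow> c"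
proof (rule tendsto_div_of_near[OF assms(1)])
  have "\<forall>\<^sub>F N in sequentially. 0 < \<mu> N" using assms(1) by (simp add: filterlim_at_top_dense)
  then show "\<forall>\<^sub>F N in sequentially. \<bar>real (nat \<lceil>c * \<mu> N\<rceil>) - c * \<mu> N\<bar> \<le> 1"
  proof eventually_elim
    case (elim N)
    then have "0 \<le> c * \<mu> N" using assms(2) by simp
    then show ?case by linarith
  qed
qed

text \<open>The denominator equals \<open>fact n / fact r\<close>, so the logarithm splits into the
  normalised logarithms of \<open>fact r\<close> and \<open>fact n\<close>, with limits belonging to
  the ratios 1 and \<open>1 + \<gamma>\<close>.\<close>

lemma tendsto_ln_factorial_moment:
  fixes \<mu> :: "nat \<Rightarrow> real" and n r :: "nat \<Rightarrow> nat"
  assumes \<mu>: "filterlim \<mu> at_top sequentially" and "0 < \<gamma>"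
    and n: "(\<lambda>N. n N / \<mu> N) \<longlonglongrightarrow> 1 + \<gamma>" and r: "(\<lambda>N. r N / \<mu> N) \<longlonglongrightarrow> 1"
    and rn: "\<And>N. r N \<le> n N"
  shows "(\<lambda>N. ln (\<mu> N ^ (n N - r N) / (fact (n N - r N) * real (n N choose (n N - r N)))) / \<mu> N)
    \<longlonglongrightarrow> - ((1 + \<gamma>) * ln (1 + \<gamma>) - \<gamma>)"
proof -
  have "(\<lambda>N. (ln (fact (r N)) / \<mu> N - (r N / \<mu> N) * ln (\<mu> N)) -
      (ln (fact (n N)) / \<mu> N - (n N / \<mu> N) * ln (\<mu> N)))
    \<longlonglongrightarrow> (1 * ln 1 - 1) - ((1 + \<gamma>) * ln (1 + \<gamma>) - (1 + \<gamma>))"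
    using assms by (intro tendsto_diff tendsto_ln_fact_div) auto
  also have "(1 * ln 1 - 1) - ((1 + \<gamma>) * ln (1 + \<gamma>) - (1 + \<gamma>)) = - ((1 + \<gamma>) * ln (1 + \<gamma>) - \<gamma>)"
    by simp
  finally show ?thesis
  proof (rule Lim_transform_eventually)
    have "\<forall>\<^sub>F N in sequentially. 0 < \<mu> N" using \<mu> by (simp add: filterlim_at_top_dense)
    then show "\<forall>\<^sub>F N in sequentially. (ln (fact (r N)) / \<mu> N - (r N / \<mu> N) * ln (\<mu> N)) -
        (ln (fact (n N)) / \<mu> N - (n N / \<mu> N) * ln (\<mu> N)) =
        ln (\<mu> N ^ (n N - r N) / (fact (n N - r N) * real (n N choose (n N - r N)))) / \<mu> N"
    proof eventually_elim
      case (elim N)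
      have eq: "fact (n N - r N) * real (n N choose (n N - r N)) = fact (n N) / fact (r N)"
        using rn[of N] by (simp add: binomial_fact)
      then have "ln (\<mu> N ^ (n N - r N) / (fact (n N - r N) * real (n N choose (n N - r N)))) =
          (n N - r N) * ln (\<mu> N) - (ln (fact (n N)) - ln (fact (r N)))"
        unfolding eq using elim by (simp add: ln_div ln_mult ln_realpow)
      also have "real (n N - r N) = real (n N) - real (r N)" using rn[of N] by simp
      finally have ln_eq: "ln (\<mu> N ^ (n N - r N) / (fact (n N - r N) * real (n N choose (n N - r N)))) =
          (real (n N) - real (r N)) * ln (\<mu> N) - (ln (fact (n N)) - ln (fact (r N)))" .
      show ?case unfolding ln_eq using elim by (simp add: field_simps)
    qed
  qed
qed

section \<open>The Poisson regime\<close>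

locale AP_poisson_regime =
  fixes k :: nat and p :: "nat \<Rightarrow> real"
  assumes k_ge_3: "3 \<le> k"
    and p_bounds: "N \<ge> 1 \<Longrightarrow> 0 < p N \<and> p N < 1"
    and p_lower: "much_less (\<lambda>N. 1 / real N) (\<lambda>N. p N powr (real k / 2))"
    and p_upper: "much_less (\<lambda>N. p N powr (real k / 2)) (\<lambda>N. ln (real N) / real N)"
begin

abbreviation \<mu> :: "nat \<Rightarrow> real" where "\<mu> N \<equiv> AP_mean k N (p N)"

text \<open>The square of \<open>x\<close> is \<open>N ^ 2 * p ^ k\<close>, the order of the mean;
  the hypotheses say that \<open>x\<close> tends to infinity and is of smaller order than
  \<open>ln N\<close>.\<close>

definition x :: "nat \<Rightarrow> real" where "x N = real N * p N powr (real k / 2)"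

text \<open>An explicit function of \<open>N\<close> that eventually dominates the square root of
  \<open>p N\<close>, hence also \<open>p N\<close>. Replacing \<open>p\<close> by it turns the
  error terms into concrete asymptotic expressions.\<close>

definition q :: "nat \<Rightarrow> real" where "q N = (ln N / N) powr (1 / k)"

lemma x_pos: "1 \<le> N \<Longrightarrow> 0 < x N"
  using p_bounds[of N] by (simp add: x_def)

lemma x_at_top: "filterlim x at_top sequentially"
proof -
  have "(\<lambda>N. inverse (x N)) \<longlonglongrightarrow> 0"
    using p_lower by (simp add: much_less_def x_def field_simps)
  then have "filterlim (\<lambda>N. inverse (inverse (x N))) at_top sequentially"
    by (rule filterlim_inverse_at_top)
      (rule eventually_mono[OF eventually_ge_at_top[of 1]], simp add: x_pos)
  then show ?thesis by simp
qed

lemma x_div_ln: "(\<lambda>N. x N / ln N) \<longlonglongrightarrow> 0"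
  using p_upper by (simp add: much_less_def x_def mult.commute)

lemma mean_bounds: "\<forall>\<^sub>F N in sequentially. x N ^ 2 / (16 * k) \<le> \<mu> N \<and> \<mu> N \<le> x N ^ 2"
  using eventually_ge_at_top[of "2 * k"]
proof eventually_elim
  case (elim N)
  then have pN: "0 < p N" "p N < 1" using p_bounds[of N] k_ge_3 by auto
  then have "(p N powr (real k / 2))\<^sup>2 = p N powr (real k / 2 + real k / 2)"
    by (simp only: power2_eq_square powr_add)
  also have "\<dots> = p N ^ k" using pN by (simp add: powr_realpow)
  finally have x2: "x N ^ 2 = (real N)\<^sup>2 * p N ^ k" by (simp add: x_def power_mult_distrib)
  have "(real N)\<^sup>2 / (16 * k) * p N ^ k \<le> card (AP_sets k N) * p N ^ k"
    using elim k_ge_3 pN by (intro mult_right_mono card_AP_sets_ge) auto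
  moreover have "real (card (AP_sets k N)) * p N ^ k \<le> real (N\<^sup>2) * p N ^ k"
    using k_ge_3 pN by (intro mult_right_mono of_nat_mono card_AP_sets_le) auto
  ultimately show ?case using AP_mean_eq[OF k_ge_3 pN] by (simp add: x2)
qed

lemma mean_at_top: "filterlim \<mu> at_top sequentially"
proof (rule filterlim_at_top_mono)
  have "filterlim (\<lambda>N. x N ^ 2 * (1 / (16 * k))) at_top sequentially"
    using k_ge_3 by (intro filterlim_at_top_mult_tendsto_pos tendsto_const filterlim_pow_at_top x_at_top) auto
  then show "filterlim (\<lambda>N. x N ^ 2 / (16 * k)) at_top sequentially" by simp
  show "\<forall>\<^sub>F N in sequentially. x N ^ 2 / (16 * k) \<le> \<mu> N" using mean_bounds by eventually_elim auto
qed

lemma mean_pos: "\<forall>\<^sub>F N in sequentially. 0 < \<mu> N"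
  using mean_at_top by (simp add: filterlim_at_top_dense)

lemma sqrt_mean_div_ln: "(\<lambda>N. sqrt (\<mu> N) / ln N) \<longlonglongrightarrow> 0"
proof (rule Lim_null_comparison[OF _ x_div_ln])
  show "\<forall>\<^sub>F N in sequentially. norm (sqrt (\<mu> N) / ln N) \<le> x N / ln N"
    using mean_bounds mean_pos eventually_ge_at_top[of 2]
  proof eventually_elim
    case (elim N)
    then have "sqrt (\<mu> N) \<le> x N" using x_pos[of N] by (intro real_le_lsqrt) auto
    then show ?case using elim by (simp add: divide_right_mono)
  qed
qed

lemma x_le_ln: "\<forall>\<^sub>F N in sequentially. x N \<le> ln N"
  using order_tendstoD(2)[OF x_div_ln zero_less_one] eventually_ge_at_top[of 2]
  by eventually_elim (simp add: field_simps)

lemma mean_le_ln_squared: "\<forall>\<^sub>F N in sequentially. \<mu> N \<le> ln N ^ 2"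
  using mean_bounds x_le_ln eventually_ge_at_top[of 1]
proof eventually_elim
  case (elim N)
  then show ?case using power_mono[of "x N" "ln N" 2] x_pos[of N] by linarith
qed

lemma p_le_q: "\<forall>\<^sub>F N in sequentially. p N \<le> q N \<and> N * p N ^ (k - 1) \<le> ln N * q N"
  using x_le_ln eventually_ge_at_top[of 2]
proof eventually_elim
  case (elim N)
  then have pN: "0 < p N" "p N < 1" using p_bounds[of N] by auto
  have "p N powr (real k / 2) \<le> ln N / N" using elim by (simp add: x_def field_simps)
  then have "(p N powr (real k / 2)) powr (1 / k) \<le> q N"
    unfolding q_def by (intro powr_mono2) auto
  then have half: "p N powr (1 / 2) \<le> q N" using k_ge_3 by (simp add: powr_powr)
  have "p N powr 1 \<le> p N powr (1 / 2)" using pN by (intro powr_mono') auto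
  then have 1: "p N \<le> q N" using half pN by simp
  have "N * p N ^ (k - 1) = N * p N powr (real k - 1)"
    using k_ge_3 pN by (simp add: powr_realpow[symmetric] of_nat_diff)
  \<comment> \<open>One factor \<open>p powr (k / 2)\<close> combines with \<open>N\<close> to
    \<open>x N\<close>. The remaining exponent \<open>k / 2 - 1\<close> is at least 1/2 because
    \<open>k \<ge> 3\<close>.\<close>
  also have "real k - 1 = real k / 2 + (real k / 2 - 1)" by simp
  also have "N * p N powr \<dots> = x N * p N powr (real k / 2 - 1)" by (simp only: x_def powr_add mult.assoc)
  also have "\<dots> \<le> ln N * p N powr (1 / 2)"
    using k_ge_3 pN elim x_pos[of N] by (intro mult_mono powr_mono') auto
  also have "\<dots> \<le> ln N * q N" using half elim by (intro mult_left_mono) auto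
  finally show ?case using 1 by simp
qed

text \<open>The bound is uniform in \<open>u\<close> and \<open>b\<close>, since both will depend on
  \<open>N\<close>.\<close>

lemma overlap_le:
  "\<forall>\<^sub>F N in sequentially. \<forall>u (b :: real). real u \<le> b \<longrightarrow>
     AP_overlap k N (p N) u \<le> b * (k * (ln N * q N)) + b ^ 2 * k\<^sup>2 * q N"
  using p_le_q eventually_ge_at_top[of 1]
proof eventually_elim
  case (elim N)
  have pN: "0 < p N" using elim p_bounds by auto
  show ?case
  proof (intro allI impI)
    fix u :: nat and b :: real assume u: "u \<le> b"
    have "k * (N * p N ^ (k - 1)) \<le> k * (ln N * q N)"
      using elim by (intro mult_left_mono) auto
    then have "u * (k * (N * p N ^ (k - 1))) \<le> b * (k * (ln N * q N))"
      using u pN by (intro mult_mono[OF u]) auto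
    moreover have "real u ^ 2 * k\<^sup>2 * p N \<le> b ^ 2 * k\<^sup>2 * q N"
      using u elim pN by (intro mult_mono power_mono) auto
    ultimately show "AP_overlap k N (p N) u \<le> b * (k * (ln N * q N)) + b ^ 2 * k\<^sup>2 * q N"
      by (simp add: AP_overlap_def mult.assoc)
  qed
qed

lemma AP_overlap_nonneg: "1 \<le> N \<Longrightarrow> 0 \<le> AP_overlap k N (p N) u"
  using p_bounds[of N] by (simp add: AP_overlap_def)

lemma p_tendsto_0: "p \<longlonglongrightarrow> 0"
proof (rule Lim_null_comparison)
  show "\<forall>\<^sub>F N in sequentially. norm (p N) \<le> q N"
    using p_le_q eventually_ge_at_top[of 1] by eventually_elim (use p_bounds in \<open>force simp: abs_if\<close>)
  have "0 < real k" using k_ge_3 by simp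
  then show "q \<longlonglongrightarrow> 0" unfolding q_def by real_asymp
qed

text \<open>Up to powers of \<open>ln N\<close> the left side is at most \<open>q N\<close>, which
  is about \<open>N powr (- 1 / k)\<close>; giving up half of the exponent absorbs the
  logarithms.\<close>

lemma cluster_factor_le:
  "\<forall>\<^sub>F N in sequentially. \<forall>u. real u \<le> ln N \<longrightarrow>
     AP_overlap k N (p N) u + \<mu> N * AP_overlap k N (p N) k \<le> N powr (- 1 / (2 * k))"
proof -
  have K: "0 < real k" using k_ge_3 by simp
  define b where "b = (\<lambda>N::nat. ln N * (k * (ln N * q N)) + ln N ^ 2 * k\<^sup>2 * q N +
    ln N ^ 2 * (k * (k * (ln N * q N)) + k\<^sup>2 * k\<^sup>2 * q N))"
  have "(\<lambda>N. b N * N powr (1 / (2 * k))) \<longlonglongrightarrow> 0"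
    unfolding b_def q_def using K by simp real_asymp
  then have "\<forall>\<^sub>F N in sequentially. b N * N powr (1 / (2 * k)) < 1"
    by (rule order_tendstoD) simp
  then have "\<forall>\<^sub>F N in sequentially. b N \<le> N powr (- 1 / (2 * k))"
    using eventually_ge_at_top[of 1]
  proof eventually_elim
    case (elim N)
    then show ?case by (simp add: powr_minus field_simps)
  qed
  then show ?thesis using overlap_le mean_le_ln_squared mean_pos eventually_ge_at_top[of 2]
  proof eventually_elim
    case (elim N)
    have "\<mu> N * AP_overlap k N (p N) k \<le> ln N ^ 2 * (k * (k * (ln N * q N)) + k\<^sup>2 * k\<^sup>2 * q N)"
      using elim AP_overlap_nonneg[of N k] elim(2)[rule_format, of k "real k"]
      by (intro mult_mono) auto
    then show ?case using elim(1,2) unfolding b_def by fastforce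
  qed
qed

section \<open>Upper bound for the tail\<close>

text \<open>About \<open>(1 + \<gamma>) * \<mu>\<close> progressions are to be disjoint, and the
  remaining \<open>(\<delta> - \<gamma>) * \<mu>\<close> are allowed to be crossing. The matching
  term and the cluster term each satisfy the exponential bound, whence the factor 2.\<close>

lemma tail_upper_bound:
  assumes "0 < \<gamma>" "\<gamma> < \<delta>" "0 < e"
  shows "\<forall>\<^sub>F N in sequentially. AP_upper_tail k N (p N) \<delta> \<le>
    2 * exp (- ((1 + \<gamma>) * ln (1 + \<gamma>) - \<gamma> - e) * \<mu> N)"
proof -
  define h where "h = (1 + \<gamma>) * ln (1 + \<gamma>) - \<gamma>"
  define c where "c = sqrt (\<delta> - \<gamma>)"
  have c: "0 < c" "c ^ 2 = \<delta> - \<gamma>" using assms by (auto simp: c_def)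
  define n where "n = (\<lambda>N. nat \<lfloor>(1 + \<gamma>) * \<mu> N\<rfloor>)"
  \<comment> \<open>The factorial moment of order \<open>n - r\<close> is optimal for \<open>r \<approx> \<mu>\<close>.\<close>
  define r where "r = (\<lambda>N. min (n N) (nat \<lfloor>1 * \<mu> N\<rfloor>))"
  \<comment> \<open>The largest number of steps for which
    \<open>(2 * k * m)\<^sup>2 * k\<^sup>2\<close> stays within the allowance
    \<open>c ^ 2 * \<mu> N\<close> for crossing progressions.\<close>
  define m where "m = (\<lambda>N. nat \<lfloor>c * sqrt (\<mu> N) / (2 * k\<^sup>2)\<rfloor>)"
  have k: "0 < real k" using k_ge_3 by simp
  have lim_n: "(\<lambda>N. n N / \<mu> N) \<longlonglongrightarrow> 1 + \<gamma>"
    unfolding n_def using assms by (intro tendsto_nat_floor_div mean_at_top) auto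
  have "(\<lambda>N. real (nat \<lfloor>1 * \<mu> N\<rfloor>) / \<mu> N) \<longlonglongrightarrow> 1"
    by (intro tendsto_nat_floor_div mean_at_top) auto
  \<comment> \<open>The minimum ensures \<open>r N \<le> n N\<close> for every \<open>N\<close>;
    eventually it is the floor of the mean.\<close>
  then have lim_r: "(\<lambda>N. r N / \<mu> N) \<longlonglongrightarrow> 1"
  proof (rule Lim_transform_eventually)
    show "\<forall>\<^sub>F N in sequentially. real (nat \<lfloor>1 * \<mu> N\<rfloor>) / \<mu> N = r N / \<mu> N"
      using mean_pos
    proof eventually_elim
      case (elim N)
      then have "1 * \<mu> N \<le> (1 + \<gamma>) * \<mu> N" using assms by (intro mult_right_mono) auto
      then have "nat \<lfloor>1 * \<mu> N\<rfloor> \<le> n N" unfolding n_def by (intro nat_mono floor_mono)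
      then show ?case by (simp add: r_def)
    qed
  qed
  let ?T = "\<lambda>N. \<mu> N ^ (n N - r N) / (fact (n N - r N) * real (n N choose (n N - r N)))"
  have "(\<lambda>N. ln (?T N) / \<mu> N) \<longlonglongrightarrow> - h"
    unfolding h_def by (rule tendsto_ln_factorial_moment[OF mean_at_top assms(1) lim_n lim_r]) (simp add: r_def)
  then have "\<forall>\<^sub>F N in sequentially. ln (?T N) / \<mu> N < - h + e"
    by (rule order_tendstoD) (use assms in simp)
  then have T: "\<forall>\<^sub>F N in sequentially. ?T N \<le> exp (- (h - e) * \<mu> N)"
    using mean_pos
  proof eventually_elim
    case (elim N)
    then have "ln (?T N) \<le> - (h - e) * \<mu> N" by (simp add: field_simps)
    moreover have "0 < ?T N" using elim by (simp add: r_def)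
    ultimately show ?case by (metis exp_le_cancel_iff exp_ln)
  qed
  define H where "H = \<bar>h\<bar> + 1"
  have H: "0 < H" by (simp add: H_def add_nonneg_pos)
  \<comment> \<open>Chosen so that \<open>H * d\<close> is the product of
    \<open>c / (4 * k\<^sup>2)\<close>, from the lower bound on \<open>m\<close>, and
    \<open>1 / (2 * k)\<close>, from the cluster factor.\<close>
  define d where "d = c / (8 * k ^ 3 * H)"
  have d: "0 < d" using c k H by (simp add: d_def)
  have m_le: "\<forall>\<^sub>F N in sequentially. 2 * k\<^sup>2 * m N \<le> c * sqrt (\<mu> N)"
    using mean_pos
  proof eventually_elim
    case (elim N)
    then have "0 \<le> c * sqrt (\<mu> N) / (2 * k\<^sup>2)" using c k by simp
    then have "real (m N) \<le> c * sqrt (\<mu> N) / (2 * k\<^sup>2)" unfolding m_def by linarith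
    then show ?case using k by (simp add: field_simps)
  qed
  have sqrt_top: "filterlim (\<lambda>N. sqrt (\<mu> N)) at_top sequentially"
    by (rule filterlim_compose[OF sqrt_at_top mean_at_top])
  then have "\<forall>\<^sub>F N in sequentially. 4 * k\<^sup>2 / c \<le> sqrt (\<mu> N)" by (simp add: filterlim_at_top)
  \<comment> \<open>Beyond this threshold the value before rounding is at least 2, so the floor
    loses at most half of it.\<close>
  then have m_ge: "\<forall>\<^sub>F N in sequentially. c * sqrt (\<mu> N) / (4 * k\<^sup>2) \<le> m N"
  proof eventually_elim
    case (elim N)
    then have "1 \<le> c * sqrt (\<mu> N) / (4 * k\<^sup>2)" using c k by (simp add: field_simps)
    moreover have "c * sqrt (\<mu> N) / (2 * k\<^sup>2) - 1 \<le> m N" unfolding m_def by linarith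
    moreover have "c * sqrt (\<mu> N) / (2 * k\<^sup>2) = 2 * (c * sqrt (\<mu> N) / (4 * k\<^sup>2))" by simp
    ultimately show ?case by linarith
  qed
  have sqrt_le: "\<forall>\<^sub>F N in sequentially. sqrt (\<mu> N) \<le> a * ln N" if "0 < a" for a
    using order_tendstoD(2)[OF sqrt_mean_div_ln that] eventually_ge_at_top[of 2]
    by eventually_elim (simp add: field_simps)
  have inv_c: "0 < 1 / c" using c by simp
  show ?thesis
    using T m_le m_ge cluster_factor_le sqrt_le[OF d] sqrt_le[OF inv_c] mean_pos eventually_ge_at_top[of 2]
  proof eventually_elim
    case (elim N)
    then have pN: "0 < p N" "p N < 1" using p_bounds[of N] by auto
    let ?\<eta> = "AP_overlap k N (p N) (2 * k * m N) + \<mu> N * AP_overlap k N (p N) k"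
    have "real (2 * k\<^sup>2 * m N) ^ 2 \<le> (c * sqrt (\<mu> N)) ^ 2" using elim by (intro power_mono) auto
    also have "\<dots> = (\<delta> - \<gamma>) * \<mu> N" using elim c by (simp add: power_mult_distrib)
    finally have sq: "real (2 * k\<^sup>2 * m N) ^ 2 \<le> (\<delta> - \<gamma>) * \<mu> N" .
    have "real (n N) \<le> (1 + \<gamma>) * \<mu> N" unfolding n_def using elim assms by simp
    then have "real (n N) + (2 * k * m N)\<^sup>2 * k\<^sup>2 \<le> (1 + \<delta>) * \<mu> N"
      using sq by (simp add: power2_eq_square algebra_simps)
    then have le: "AP_upper_tail k N (p N) \<delta> \<le> ?T N + ?\<eta> ^ m N"
      using pN by (intro AP_upper_tail_le k_ge_3) auto
    \<comment> \<open>The clusters have at most \<open>ln N\<close> points, as the bound on the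
      cluster factor demands.\<close>
    have "2 * k * m N \<le> 2 * k * k * m N" using k_ge_3 by simp
    then have "real (2 * k * m N) \<le> 2 * k\<^sup>2 * m N" by (simp add: power2_eq_square flip: of_nat_mult)
    also have "\<dots> \<le> ln N" using elim c by (simp add: field_simps)
    finally have "?\<eta> \<le> N powr (- 1 / (2 * k))" using elim(4) by blast
    then have "?\<eta> ^ m N \<le> (N powr (- 1 / (2 * k))) ^ m N"
      using elim AP_overlap_nonneg[of N] by (intro power_mono) auto
    also have "\<dots> = exp (- (m N * (ln N / (2 * k))))"
      using elim by (simp add: powr_def exp_of_nat_mult[symmetric])
    also have "\<dots> \<le> exp (- (h - e) * \<mu> N)"
    proof -
      have "h - e \<le> H" using assms by (simp add: H_def)
      then have "(h - e) * \<mu> N \<le> H * (sqrt (\<mu> N) * sqrt (\<mu> N))"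
        using elim H by (simp add: mult_right_mono)
      \<comment> \<open>One of the two factors \<open>sqrt (\<mu> N)\<close> is traded for
        \<open>d * ln N\<close>, because the mean is of smaller order than the square of
        \<open>ln N\<close>.\<close>
      also have "\<dots> \<le> H * (sqrt (\<mu> N) * (d * ln N))"
        using elim H by (intro mult_left_mono) auto
      also have "\<dots> = c * sqrt (\<mu> N) / (4 * k\<^sup>2) * (ln N / (2 * k))"
        using k H by (simp add: d_def power2_eq_square power3_eq_cube mult_ac)
      also have "\<dots> \<le> m N * (ln N / (2 * k))" using elim by (intro mult_right_mono) auto
      finally show ?thesis by (simp add: algebra_simps)    qed
    finally show ?case using le elim(1) by (simp add: h_def)
  qed
qed

section \<open>Lower bound for the tail\<close>

lemma tail_lower_bound:
  assumes "0 < \<delta>" "0 < e"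
  shows "\<forall>\<^sub>F N in sequentially.
    exp (- ((1 + \<delta>) * ln (1 + \<delta>) - \<delta> + e) * \<mu> N) \<le> AP_upper_tail k N (p N) \<delta>"
proof -
  have k: "0 < real k" using k_ge_3 by simp
  define h where "h = (1 + \<delta>) * ln (1 + \<delta>) - \<delta>"
  define n where "n = (\<lambda>N. nat \<lceil>(1 + \<delta>) * \<mu> N\<rceil>)"
  \<comment> \<open>The part \<open>1 + \<delta>\<close> comes from the mean, the additional 1 from
    rounding up.\<close>
  define C where "C = 2 + \<delta>"
  have C: "0 < C" using assms by (simp add: C_def)
  have lim_n: "(\<lambda>N. n N / \<mu> N) \<longlonglongrightarrow> 1 + \<delta>"
    unfolding n_def using assms by (intro tendsto_nat_ceiling_div mean_at_top) auto
  have "filterlim (\<lambda>N. ln (real N)) at_top sequentially"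
    by (rule filterlim_compose[OF ln_at_top filterlim_real_sequentially])
  then have ln_ge_1: "\<forall>\<^sub>F N in sequentially. 1 \<le> ln (real N)" by (simp add: filterlim_at_top)
  have n_le: "\<forall>\<^sub>F N in sequentially. n N \<le> C * ln N ^ 2"
    using mean_pos mean_le_ln_squared ln_ge_1
  proof eventually_elim
    case (elim N)
    have "0 \<le> (1 + \<delta>) * \<mu> N" using elim assms by simp
    then have "real (n N) \<le> (1 + \<delta>) * \<mu> N + 1" unfolding n_def by linarith
    also have "\<dots> \<le> (1 + \<delta>) * ln N ^ 2 + ln N ^ 2"
      using elim assms by (intro add_mono mult_left_mono one_le_power) auto
    finally show ?case by (simp add: C_def algebra_simps)
  qed
  let ?M = "\<lambda>N. card (AP_sets k N)"
  let ?b = "\<lambda>N. AP_bad_count k N (n N)"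
  let ?o = "\<lambda>N. AP_overlap k N (p N) (k * n N)"
  \<comment> \<open>Since \<open>n\<close> is at most polylogarithmic, the bad edges number at most
    \<open>N\<close> times powers of \<open>ln N\<close>, against order \<open>N ^ 2\<close>
    progressions.\<close>
  have bad: "(\<lambda>N. ?b N / ?M N) \<longlonglongrightarrow> 0"
  proof (rule Lim_null_comparison)
    let ?B = "\<lambda>N. C * ln N ^ 2 + (k * (C * ln N ^ 2))^2 * k\<^sup>2 * (k * (k * N)) + k * (C * ln N ^ 2) * (k * N) * (k\<^sup>2 * k\<^sup>2)"
    show "(\<lambda>N. ?B N / (real N ^ 2 / (16 * k))) \<longlonglongrightarrow> 0" using k C by simp real_asymp
    show "\<forall>\<^sub>F N in sequentially. norm (?b N / ?M N) \<le> ?B N / (real N ^ 2 / (16 * k))"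
      using n_le eventually_ge_at_top[of "2 * k"]
    proof eventually_elim
      case (elim N)
      have "real (?b N) = real (n N) + ((real k * real (n N))\<^sup>2 * real (k\<^sup>2) * real (k * (k * N)) +
          real k * real (n N) * real (k * N) * real (k\<^sup>2 * k\<^sup>2))"
        by (simp add: AP_bad_count_def)
      also have "\<dots> \<le> C * ln N ^ 2 + ((k * (C * ln N ^ 2))\<^sup>2 * k\<^sup>2 * (k * (k * N)) + k * (C * ln N ^ 2) * (k * N) * (k\<^sup>2 * k\<^sup>2))"
        using elim C by (intro add_mono mult_right_mono power_mono mult_left_mono) auto
      finally have "real (?b N) \<le> ?B N" by simp
      moreover have "real N ^ 2 / (16 * k) \<le> ?M N" using elim k_ge_3 by (intro card_AP_sets_ge) auto
      moreover have "0 < real N ^ 2 / (16 * k)" using elim k_ge_3 by simp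
      ultimately have "?b N / ?M N \<le> ?B N / (real N ^ 2 / (16 * k))"
        by (intro frac_le) auto
      then show ?case by simp
    qed
  qed
  have ov: "(\<lambda>N. ?o N / \<mu> N) \<longlonglongrightarrow> 0"
  proof -
    have "?o \<longlonglongrightarrow> 0"
    proof (rule Lim_null_comparison)
      let ?B = "\<lambda>N. (k * (C * ln N ^ 2)) * (k * (ln N * q N)) + (k * (C * ln N ^ 2)) ^ 2 * k\<^sup>2 * q N"
      show "?B \<longlonglongrightarrow> 0" unfolding q_def using k C by simp real_asymp
      show "\<forall>\<^sub>F N in sequentially. norm (?o N) \<le> ?B N"
        using n_le overlap_le eventually_ge_at_top[of 1]
      proof eventually_elim
        case (elim N)
        have "real (k * n N) \<le> k * (C * ln N ^ 2)" using elim by (simp add: mult_left_mono)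
        then show ?case using elim(2) AP_overlap_nonneg[OF elim(3)] by (simp del: of_nat_mult)
      qed
    qed
    then have "(\<lambda>N. ?o N * inverse (\<mu> N)) \<longlonglongrightarrow> 0 * 0"
      using tendsto_inverse_0_at_top[OF mean_at_top] by (rule tendsto_mult)
    then show ?thesis by (simp add: divide_inverse)
  qed
  let ?L = "\<lambda>N. real (?M N - ?b N) ^ n N / fact (n N) * (p N ^ k) ^ n N * exp (- (\<mu> N + ?o N) / (1 - p N))"
  \<comment> \<open>This is \<open>ln (?L N) / \<mu> N\<close>, using that the number of
    progressions times \<open>p ^ k\<close> is the mean. In the limit the last term gives -1, which
    turns \<open>1 + \<delta>\<close> from the factorial into \<delta>.\<close>
  let ?l = "\<lambda>N. (n N / \<mu> N) * ln (1 - ?b N / ?M N) -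
    (ln (fact (n N)) / \<mu> N - (n N / \<mu> N) * ln (\<mu> N)) - (1 + ?o N / \<mu> N) / (1 - p N)"
  have "?l \<longlonglongrightarrow> (1 + \<delta>) * ln (1 - 0) - ((1 + \<delta>) * ln (1 + \<delta>) - (1 + \<delta>)) - (1 + 0) / (1 - 0)"
    using assms by (intro tendsto_intros lim_n bad ov p_tendsto_0 tendsto_ln_fact_div mean_at_top) auto
  then have "?l \<longlonglongrightarrow> - h" by (simp add: h_def)
  then have "\<forall>\<^sub>F N in sequentially. - h - e < ?l N"
    by (rule order_tendstoD) (use assms in simp)
  then show ?thesis
    using order_tendstoD(2)[OF bad zero_less_one] mean_pos eventually_ge_at_top[of "2 * k"]
  proof eventually_elim
    case (elim N)
    then have pN: "0 < p N" "p N < 1" using p_bounds[of N] k_ge_3 by auto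
    have mean: "\<mu> N = ?M N * p N ^ k" by (rule AP_mean_eq[OF k_ge_3 pN])
    then have M: "0 < real (?M N)" using elim pN by (simp add: zero_less_mult_iff)
    then have "?b N < ?M N" using elim by (simp add: field_simps)
    then have Mb: "real (?M N - ?b N) * p N ^ k = \<mu> N * (1 - ?b N / ?M N)"
      using M by (simp add: mean of_nat_diff field_simps)
    define \<beta> where "\<beta> = ?b N / ?M N"
    have \<beta>: "0 < 1 - \<beta>" using elim by (simp add: \<beta>_def)
    have L: "?L N = (\<mu> N * (1 - \<beta>)) ^ n N / fact (n N) * exp (- ((\<mu> N + ?o N) / (1 - p N)))"
      unfolding \<beta>_def Mb[symmetric] by (simp only: power_mult_distrib minus_divide_left times_divide_eq_left)
    then have L_pos: "0 < ?L N" using \<beta> elim by simp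
    have "ln (?L N) = n N * (ln (\<mu> N) + ln (1 - \<beta>)) - ln (fact (n N)) - (\<mu> N + ?o N) / (1 - p N)"
      unfolding L using \<beta> elim by (simp add: ln_mult ln_div ln_realpow)
    also have "\<dots> = \<mu> N * ?l N"
      unfolding \<beta>_def[symmetric] using elim pN by (simp add: field_simps)
    also have "\<mu> N * (- h - e) \<le> \<dots>" using elim by (intro mult_left_mono) auto
    finally have "- (h + e) * \<mu> N \<le> ln (?L N)" by (simp add: algebra_simps)
    then have "exp (- (h + e) * \<mu> N) \<le> ?L N" using L_pos by (metis exp_le_cancel_iff exp_ln)
    also have "\<dots> \<le> AP_upper_tail k N (p N) \<delta>"
      by (intro AP_upper_tail_ge k_ge_3 pN) (simp add: n_def, linarith)
    finally show ?case by (simp add: h_def)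
  qed
qed

section \<open>The limit of the normalised logarithm\<close>

theorem tail_rate:
  assumes "0 < \<delta>"
  shows "(\<lambda>N. - ln (AP_upper_tail k N (p N) \<delta>) / \<mu> N) \<longlonglongrightarrow> (1 + \<delta>) * ln (1 + \<delta>) - \<delta>"
proof (rule order_tendstoI)
  let ?h = "\<lambda>\<delta>::real. (1 + \<delta>) * ln (1 + \<delta>) - \<delta>"
  fix a assume a: "a < ?h \<delta>"
  \<comment> \<open>The upper bound yields the rate only at \<gamma> below \<delta>; by continuity
    some such \<gamma> still has a rate above \<open>a\<close>.\<close>
  have "isCont ?h \<delta>" using assms by (intro continuous_intros) auto
  then have "(?h \<longlongrightarrow> ?h \<delta>) (at_left \<delta>)"
    by (simp add: isCont_def filterlim_at_split)
  then have "\<forall>\<^sub>F \<gamma> in at_left \<delta>. a < ?h \<gamma>" using a by (rule order_tendstoD)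
  moreover have "\<forall>\<^sub>F \<gamma> in at_left \<delta>. \<gamma> \<in> {0<..<\<delta>}"
    using assms by (rule eventually_at_left_real)
  ultimately have "\<forall>\<^sub>F \<gamma> in at_left \<delta>. a < ?h \<gamma> \<and> \<gamma> \<in> {0<..<\<delta>}"
    by eventually_elim auto
  then obtain \<gamma> where \<gamma>: "a < ?h \<gamma>" "0 < \<gamma>" "\<gamma> < \<delta>"
    using eventually_happens'[OF trivial_limit_at_left_real] by fastforce
  \<comment> \<open>Half of the gap is spent on the error in the exponent, the other half on the
    factor 2.\<close>
  define e where "e = (?h \<gamma> - a) / 2"
  have e: "0 < e" using \<gamma> by (simp add: e_def)
  have "\<forall>\<^sub>F N in sequentially. ln 2 / e < \<mu> N" using mean_at_top by (simp add: filterlim_at_top_dense)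
  then show "\<forall>\<^sub>F N in sequentially. a < - ln (AP_upper_tail k N (p N) \<delta>) / \<mu> N"
    using tail_upper_bound[OF \<gamma>(2,3) e] tail_lower_bound[OF assms zero_less_one] mean_pos
  proof eventually_elim
    case (elim N)
    \<comment> \<open>The lower tail bound, taken with error 1, only shows that the probability is
      positive, so that its logarithm can be compared.\<close>
    have pos: "0 < AP_upper_tail k N (p N) \<delta>" using elim(3) exp_gt_zero less_le_trans by blast
    then have "ln (AP_upper_tail k N (p N) \<delta>) \<le> ln (2 * exp (- (?h \<gamma> - e) * \<mu> N))"
      using elim(2) by (subst ln_le_cancel_iff) auto
    also have "\<dots> = ln 2 - (?h \<gamma> - e) * \<mu> N" by (simp add: ln_mult algebra_simps)
    also have "\<dots> < e * \<mu> N - (?h \<gamma> - e) * \<mu> N" using elim(1) e by (simp add: field_simps)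
    also have "\<dots> = - a * \<mu> N" by (simp add: e_def field_simps)
    finally show ?case using elim(4) by (simp add: field_simps)
  qed
next
  let ?h = "\<lambda>\<delta>::real. (1 + \<delta>) * ln (1 + \<delta>) - \<delta>"
  fix a assume a: "?h \<delta> < a"
  define e where "e = (a - ?h \<delta>) / 2"
  have e: "0 < e" using a by (simp add: e_def)
  show "\<forall>\<^sub>F N in sequentially. - ln (AP_upper_tail k N (p N) \<delta>) / \<mu> N < a"
    using tail_lower_bound[OF assms e] mean_pos
  proof eventually_elim
    case (elim N)
    then have "ln (exp (- (?h \<delta> + e) * \<mu> N)) \<le> ln (AP_upper_tail k N (p N) \<delta>)"
      by (subst ln_le_cancel_iff) (auto intro: less_le_trans[OF exp_gt_zero])
    then have "- ln (AP_upper_tail k N (p N) \<delta>) \<le> (?h \<delta> + e) * \<mu> N" by (simp add: algebra_simps)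
    also have "\<dots> < a * \<mu> N" using elim e by (intro mult_strict_right_mono) (auto simp: e_def field_simps)
    finally show ?case using elim by (simp add: field_simps)
  qed
qed

end

theorem theorem1p4:
  fixes k :: nat and \<delta> :: real and p :: "nat \<Rightarrow> real"
  assumes "k \<ge> 3"
    and "\<delta> > 0"
    and "\<And>N. N \<ge> 1 \<Longrightarrow> 0 < p N \<and> p N < 1"
    and "much_less (\<lambda>N. 1 / real N) (\<lambda>N. p N powr (real k / 2))"
    and "much_less (\<lambda>N. p N powr (real k / 2)) (\<lambda>N. ln (real N) / real N)"
  shows "(\<lambda>N. - ln (AP_upper_tail k N (p N) \<delta>) / AP_mean k N (p N))
           \<longlonglongrightarrow> (1 + \<delta>) * ln (1 + \<delta>) - \<delta>"
proof -
  interpret AP_poisson_regime k p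
    using assms by unfold_locales auto
  show ?thesis using assms(2) by (rule tail_rate)
qed

end
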